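(* Let $\mathcal A,\mathcal B\in\mathbb C^{I_1\times\dots\times I_N}$ and $2\le \hat N\le N$, and suppose that $\operatorname{col}(\mathbf A_{(n^c;n)})=\operatorname{col}(\mathbf B_{(n^c;n)})$ for $n\in\{1,\dots,\hat N\}$. Assume that $\mathcal A$ has a decomposition into ML rank-$(\tilde L_{1r},\dots,\tilde L_{\hat N r},\cdot,\dots,\cdot)$ terms $$\mathcal A=\sum_{r=1}^{\tilde R}\tilde{\mathcal D}_r\bullet_1\tilde{\mathbf X}^{(1)}_r\cdots\bullet_{\hat N}\tilde{\mathbf X}^{(\hat N)}_r,\qquad \tilde{\mathcal D}_r\in\mathbb C^{\tilde L_{1r}\times\dots\times\tilde L_{\hat N r}\times I_{\hat N+1}\times\dots\times I_N},\quad \tilde{\mathbf X}^{(n)}_r\in\mathbb C^{I_n\times\tilde L_{nr}},$$ whose concatenated factor matrices $\tilde{\mathbf X}^{(n)}:=[\tilde{\mathbf X}^{(n)}_1\ \dots\ \tilde{\mathbf X}^{(n)}_{\tilde R}]$, $n\in\{1,\dots,\hat N\}$, are square and nonsingular. Assume also that $$\mathbf B_{(n^c;n)}=\mathbf A_{(n^c;n)}\mathbf M_n,\qquad n\in\{1,\dots,\hat N\},$$ for matrices $\mathbf M_n\in\mathbb C^{I_n\times I_n}$, and that at least one of the matrices $\mathbf M_1,\dots,\mathbf M_{\hat N}$ can be diagonalized. Then the following statements hold. 1. The matrices $\mathbf M_1,\dots,\mathbf M_{\hat N}$ have the same spectrum (the same set of distinct eigenvalues; multiplicities may differ). 2. All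 matrices $\mathbf M_1,\dots,\mathbf M_{\hat N}$ can be diagonalized. 3. Let the distinct eigenvalues of $\mathbf M_n$ be $\lambda_1,\dots,\lambda_R$ with respective multiplicities $L_{n1},\dots,L_{nR}$, and let $\mathbf X^{(n)}=[\mathbf X^{(n)}_1\ \dots\ \mathbf X^{(n)}_R]\in\mathbb C^{I_n\times I_n}$, $\mathbf X^{(n)}_r\in\mathbb C^{I_n\times L_{nr}}$, be a nonsingular matrix such that $$\mathbf M_n=\left(\mathbf X^{(n)T}\right)^{-1}\operatorname{Bdiag}(\lambda_1\mathbf I_{L_{n1}},\dots,\lambda_R\mathbf I_{L_{nR}})\,\mathbf X^{(n)T},\qquad n\in\{1,\dots,\hat N\}.$$ Then $\mathcal A$ and $\mathcal B$ admit the decompositions into ML rank-$(L_{1r},\dots,L_{\hat N r},\cdot,\dots,\cdot)$ terms $$\mathcal A=\sum_{r=1}^R\mathcal D_r\bullet_1\mathbf X^{(1)}_r\cdots\bullet_{\hat N}\mathbf X^{(\hat N)}_r,\qquad \mathcal B=\sum_{r=1}^R\lambda_r\,\mathcal D_r\bullet_1\mathbf X^{(1)}_r\cdots\bullet_{\hat N}\mathbf X^{(\hat N)}_r,\qquad \lambda_1\cdots\lambda_R\neq 0,$$ with some tensors $\mathcal D_r\in\mathbb C^{L_{1r}\times\dots\times L_{\hat N r}\times I_{\hat N+1}\times\dots\times I_N}$. In particular, if $L_{nr}=1$ for all $n$ and $r$, then $\mathcal A$ and $\mathcal B$ are generated by the same (possibly scaled) $R$ rank-$1$ terms.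
   Context: Mode-$n$ matrix representation: for $\mathcal A\in\mathbb C^{I_1\times\dots\times I_N}$, $\mathbf A_{(n^c;n)}\in\mathbb C^{\frac{I_1\cdots I_N}{I_n}\times I_n}$ is the matrix whose entry in row $1+\sum_{k\ne n}(i_k-1)\prod_{l<k,\,l\ne n}I_l$ and column $i_n$ is the $(i_1,\dots,i_N)$th entry of $\mathcal A$ (its columns are the vectorized slices of $\mathcal A$ obtained by fixing the $n$th index). $\operatorname{col}(\cdot)$ denotes the column space of a matrix. Mode-$n$ product: for a tensor $\mathcal D$ whose $n$th dimension is $L_n$ and $\mathbf X\in\mathbb C^{I_n\times L_n}$, $\mathcal D\bullet_n\mathbf X$ is the tensor $\mathcal C$ with $n$th dimension $I_n$ (other dimensions unchanged) determined by $\mathbf C_{(n^c;n)}=\mathbf D_{(n^c;n)}\mathbf X^T$, i.e. all mode-$n$ fibers of $\mathcal D$ are multiplied by $\mathbf X$. Successive products $\mathcal D\bullet_1\mathbf X^{(1)}\cdots\bullet_{\hat N}\mathbf X^{(\hat N)}$ are taken from left to right. ML rank: a tensor $\mathcal A$ of order $N$ is ML (multilinear) rank-$(L_1,\dots,L_{\hat N},\cdot,\dots,\cdot)$ if $\operatorname{rank}\mathbf A_{(n^c;n)}=L_n$ for $n=1,\dots,\hat N$ (no condition for $n>\hat N$). A decomposition into ML rank-$(L_{1r},\dots,L_{\hat N r},\cdot,\dots,\cdot)$ terms is a sum whose $r$th term is ML rank-$(L_{1r},\dots,L_{\hat N r},\cdot,\dots,\cdot)$. A rank-$1$ tensor is a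 nonzero outer product of $N$ vectors. $\operatorname{Bdiag}(\cdot)$ denotes a block-diagonal matrix with the given diagonal blocks; $\mathbf I_L$ is the $L\times L$ identity matrix; ${}^T$ is the (non-conjugate) transpose.
   Formalization: In the final "in particular", when N ≥ N̂+2 it is additionally assumed that each term of the decomposition of A has mode-n rank 1 for every n > N̂; without this the sentence fails (e.g. N̂=2, dimensions 1×1×2×2, A=B the identity in the last two modes). *)

theory Defs
  imports
    "HOL-Library.FuncSet"
    "Jordan_Normal_Form.DL_Rank"
    "Jordan_Normal_Form.Spectral_Radius"
    "Jordan_Normal_Form.Gauss_Jordan_Elimination"
begin

section \<open>Tensors\<close>

text \<open>
  Modes, indices and row numbers are counted from \<open>0\<close>: mode \<open>n\<close> below is the
  mathematical mode \<open>n + 1\<close>.  A tensor carries the list of its dimensions; its entry function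
  is \<open>undefined\<close> outside the index set, so that equality of tensors is equality of the
  dimensions and of all entries.
\<close>

definition index_set :: "nat list \<Rightarrow> nat list set" where
  "index_set ds = {is. length is = length ds \<and> (\<forall>k < length ds. is ! k < ds ! k)}"

typedef 'a tensor = "{(ds :: nat list, f :: nat list \<Rightarrow> 'a). f \<in> extensional (index_set ds)}"
  by (intro exI[of _ "([], \<lambda>_. undefined)"]) (auto simp: extensional_def)

definition tensor :: "nat list \<Rightarrow> (nat list \<Rightarrow> 'a) \<Rightarrow> 'a tensor" where
  "tensor ds f = Abs_tensor (ds, restrict f (index_set ds))"

definition dims :: "'a tensor \<Rightarrow> nat list" where
  "dims A = fst (Rep_tensor A)"

definition entry :: "'a tensor \<Rightarrow> nat list \<Rightarrow> 'a" where
  "entry A = snd (Rep_tensor A)"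

lemma dims_tensor [simp]: "dims (tensor ds f) = ds"
  by (simp add: dims_def tensor_def Abs_tensor_inverse)

lemma entry_tensor [simp]: "is \<in> index_set ds \<Longrightarrow> entry (tensor ds f) is = f is"
  by (simp add: entry_def tensor_def Abs_tensor_inverse)

lemma tensor_eqI:
  assumes "dims A = dims B" and "\<And>is. is \<in> index_set (dims A) \<Longrightarrow> entry A is = entry B is"
  shows "A = B"
proof -
  obtain da f db g where A: "Rep_tensor A = (da, f)" and B: "Rep_tensor B = (db, g)"
    by (meson surj_pair)
  have "f \<in> extensional (index_set da)" "g \<in> extensional (index_set db)"
    using Rep_tensor[of A] Rep_tensor[of B] A B by auto
  moreover have "da = db" using assms(1) A B by (simp add: dims_def)
  moreover have "\<And>is. is \<in> index_set da \<Longrightarrow> f is = g is"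
    using assms(2) A B by (simp add: dims_def entry_def)
  ultimately have "f = g" by (auto intro: extensionalityI)
  with \<open>da = db\<close> A B show ?thesis by (metis Rep_tensor_inject)
qed

definition tensor_sum :: "nat list \<Rightarrow> nat \<Rightarrow> (nat \<Rightarrow> 'a tensor) \<Rightarrow> 'a :: comm_monoid_add tensor" where
  "tensor_sum ds R T = tensor ds (\<lambda>is. \<Sum>r<R. entry (T r) is)"

definition tensor_scale :: "'a \<Rightarrow> 'a tensor \<Rightarrow> 'a :: times tensor" where
  "tensor_scale c A = tensor (dims A) (\<lambda>is. c * entry A is)"


section \<open>Matrix representations and mode products\<close>

definition row_index :: "nat list \<Rightarrow> nat \<Rightarrow> nat list \<Rightarrow> nat" where
  "row_index ds n is =
     (\<Sum>k \<in> {..<length ds} - {n}. is ! k * (\<Prod>l \<in> {..<k} - {n}. ds ! l))"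

text \<open>
  The matrix \<open>\<^bold>A\<^sub>(\<^sub>n\<^sup>c\<^sub>;\<^sub>n\<^sub>)\<close>.  The index tuple selected by \<open>THE\<close> exists
  and is unique, see \<open>unfold_entry\<close> and \<open>row_index_surj\<close> below.
\<close>

definition unfold_mat :: "'a tensor \<Rightarrow> nat \<Rightarrow> 'a mat" where
  "unfold_mat A n =
     mat (\<Prod>k \<in> {..<length (dims A)} - {n}. dims A ! k) (dims A ! n)
       (\<lambda>(j, i). entry A
          (THE is. is \<in> index_set (dims A) \<and> row_index (dims A) n is = j \<and> is ! n = i))"

text \<open>
  Every mode-\<open>n\<close> fiber is multiplied by \<open>X\<close>; \<open>unfold_mode_prod\<close> below is
  the matrix form of the same operation.
\<close>

definition mode_prod :: "'a tensor \<Rightarrow> nat \<Rightarrow> 'a mat \<Rightarrow> 'a :: comm_semiring_0 tensor" where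
  "mode_prod D n X = tensor ((dims D)[n := dim_row X])
     (\<lambda>is. \<Sum>l < dim_col X. X $$ (is ! n, l) * entry D (is[n := l]))"

text \<open>The product with \<open>X 0\<close>, \dots, \<open>X (Nh - 1)\<close> in the modes \<open>0\<close>, \dots, \<open>Nh - 1\<close>, from left to right.\<close>

definition multi_prod :: "nat \<Rightarrow> 'a tensor \<Rightarrow> (nat \<Rightarrow> 'a mat) \<Rightarrow> 'a :: comm_semiring_0 tensor" where
  "multi_prod Nh D X = fold (\<lambda>n T. mode_prod T n (X n)) [0..<Nh] D"


section \<open>Ranks\<close>

definition mat_rank :: "'a :: field mat \<Rightarrow> nat" where
  "mat_rank A = vec_space.rank (dim_row A) A"

definition mat_col_space :: "'a :: field mat \<Rightarrow> 'a vec set" where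
  "mat_col_space A = vec_space.col_space (dim_row A) A"

definition ml_rank :: "nat \<Rightarrow> (nat \<Rightarrow> nat) \<Rightarrow> 'a :: field tensor \<Rightarrow> bool" where
  "ml_rank Nh L A \<longleftrightarrow> (\<forall>n < Nh. mat_rank (unfold_mat A n) = L n)"

definition rank_one :: "'a :: field tensor \<Rightarrow> bool" where
  "rank_one A \<longleftrightarrow>
     A \<noteq> tensor (dims A) (\<lambda>_. 0) \<and>
     (\<exists>v. (\<forall>n < length (dims A). v n \<in> carrier_vec (dims A ! n)) \<and>
          A = tensor (dims A) (\<lambda>is. \<Prod>n < length (dims A). v n $ (is ! n)))"

text \<open>\<open>L n r\<close> is the mode-\<open>n\<close> rank of the \<open>r\<close>th term \<open>T r\<close>.\<close>

definition ml_decomposition ::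
  "nat \<Rightarrow> nat \<Rightarrow> (nat \<Rightarrow> nat \<Rightarrow> nat) \<Rightarrow> (nat \<Rightarrow> 'a tensor) \<Rightarrow> 'a :: field tensor \<Rightarrow> bool" where
  "ml_decomposition Nh R L T A \<longleftrightarrow>
     (\<forall>r < R. dims (T r) = dims A \<and> ml_rank Nh (\<lambda>n. L n r) (T r)) \<and>
     A = tensor_sum (dims A) R T"

text \<open>The dimensions of the core tensor of the \<open>r\<close>th term.\<close>

definition core_dims :: "nat \<Rightarrow> nat list \<Rightarrow> (nat \<Rightarrow> nat \<Rightarrow> nat) \<Rightarrow> nat \<Rightarrow> nat list" where
  "core_dims Nh Is L r = map (\<lambda>n. if n < Nh then L n r else Is ! n) [0..<length Is]"


section \<open>Matrices\<close>

text \<open>The concatenation \<open>[Xs\<^sub>1 \<dots> Xs\<^sub>R]\<close> of matrices with \<open>m\<close> rows.\<close>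

definition hcat :: "nat \<Rightarrow> 'a mat list \<Rightarrow> 'a mat" where
  "hcat m Xs = mat_of_cols m (concat (map cols Xs))"

definition diagonalizable_mat :: "'a :: semiring_1 mat \<Rightarrow> bool" where
  "diagonalizable_mat M \<longleftrightarrow> (\<exists>D. diagonal_mat D \<and> similar_mat M D)"


section \<open>Basic facts on the matrix representation\<close>

lemma mixed_radix_less:
  fixes c d :: "nat \<Rightarrow> nat"
  assumes "\<And>k. k < m \<Longrightarrow> d k < c k"
  shows "(\<Sum>k<m. d k * (\<Prod>l<k. c l)) < (\<Prod>l<m. c l)"
  using assms
proof (induction m)
  case (Suc m)
  have "(\<Sum>k<Suc m. d k * (\<Prod>l<k. c l)) < (\<Prod>l<m. c l) + d m * (\<Prod>l<m. c l)"
    using Suc by simp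
  also have "\<dots> = Suc (d m) * (\<Prod>l<m. c l)" by simp
  also have "\<dots> \<le> c m * (\<Prod>l<m. c l)"
    using Suc.prems[of m] by (intro mult_right_mono) auto
  finally show ?case by (simp add: mult.commute)
qed simp

lemma mixed_radix_inj:
  fixes c d e :: "nat \<Rightarrow> nat"
  assumes "\<And>k. k < m \<Longrightarrow> d k < c k" and "\<And>k. k < m \<Longrightarrow> e k < c k"
    and "(\<Sum>k<m. d k * (\<Prod>l<k. c l)) = (\<Sum>k<m. e k * (\<Prod>l<k. c l))"
    and "k < m"
  shows "d k = e k"
  using assms
proof (induction m)
  case (Suc m)
  let ?P = "\<Prod>l<m. c l"
  let ?x = "\<Sum>k<m. d k * (\<Prod>l<k. c l)" and ?y = "\<Sum>k<m. e k * (\<Prod>l<k. c l)"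
  have lt: "?x < ?P" "?y < ?P"
    using Suc.prems by (auto intro!: mixed_radix_less)
  have eq: "?x + d m * ?P = ?y + e m * ?P"
    using Suc.prems(3) by simp
  have P: "?P \<noteq> 0" using lt by linarith
  have "(?x + d m * ?P) div ?P = d m"
    using div_mult_self1[OF P, of ?x "d m"] lt(1) by (simp only: div_less add_0_right)
  moreover have "(?y + e m * ?P) div ?P = e m"
    using div_mult_self1[OF P, of ?y "e m"] lt(2) by (simp only: div_less add_0_right)
  ultimately have "d m = e m" using eq by simp
  with eq have "?x = ?y" by simp
  show ?case
  proof (cases "k = m")
    case False
    with Suc.prems \<open>?x = ?y\<close> show ?thesis by (intro Suc.IH) auto
  qed (simp add: \<open>d m = e m\<close>)
qed simp

lemma mixed_radix_surj:
  fixes c :: "nat \<Rightarrow> nat"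
  assumes "j < (\<Prod>l<m. c l)"
  shows "\<exists>d. (\<forall>k<m. d k < c k) \<and> (\<Sum>k<m. d k * (\<Prod>l<k. c l)) = j"
  using assms
proof (induction m arbitrary: j)
  case (Suc m)
  let ?P = "\<Prod>l<m. c l"
  have P: "?P > 0" using Suc.prems by (cases "?P = 0") auto
  hence "j mod ?P < ?P" by simp
  then obtain d where d: "\<forall>k<m. d k < c k" "(\<Sum>k<m. d k * (\<Prod>l<k. c l)) = j mod ?P"
    using Suc.IH by blast
  have q: "j div ?P < c m"
    using Suc.prems P by (simp add: less_mult_imp_div_less mult.commute)
  let ?d = "d(m := j div ?P)"
  have "(\<Sum>k<m. ?d k * (\<Prod>l<k. c l)) = (\<Sum>k<m. d k * (\<Prod>l<k. c l))"
    by (intro sum.cong) auto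
  hence "(\<Sum>k<Suc m. ?d k * (\<Prod>l<k. c l)) = j"
    using d(2) mod_div_mult_eq[of j ?P] by simp
  moreover have "\<forall>k<Suc m. ?d k < c k" using d(1) q by (auto simp: less_Suc_eq)
  ultimately show ?case by blast
qed simp

lemma prod_skip:
  fixes c :: "nat \<Rightarrow> nat"
  shows "(\<Prod>l \<in> {..<k} - {n}. c l) = (\<Prod>l<k. if l = n then 1 else c l)"
  by (intro prod.mono_neutral_cong_left) auto

lemma row_index_radix:
  "row_index ds n is = (\<Sum>k < length ds.
     (if k = n then 0 else is ! k) * (\<Prod>l<k. if l = n then 1 else ds ! l))"
  unfolding row_index_def prod_skip by (intro sum.mono_neutral_cong_left) auto

lemma row_index_less:
  assumes "is \<in> index_set ds"
  shows "row_index ds n is < (\<Prod>k \<in> {..<length ds} - {n}. ds ! k)"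
  unfolding row_index_radix prod_skip
  using assms by (intro mixed_radix_less) (auto simp: index_set_def)

lemma row_index_inj:
  assumes "is \<in> index_set ds" "js \<in> index_set ds"
    and "row_index ds n is = row_index ds n js" and "is ! n = js ! n"
  shows "is = js"
proof (rule nth_equalityI)
  show "length is = length js" using assms by (simp add: index_set_def)
next
  fix k assume "k < length is"
  hence k: "k < length ds" using assms by (simp add: index_set_def)
  have "(if k = n then 0 else is ! k) = (if k = n then 0 else js ! k)"
    by (rule mixed_radix_inj[where m = "length ds" and c = "\<lambda>l. if l = n then 1 else ds ! l",
          OF _ _ assms(3)[unfolded row_index_radix] k])
      (use assms in \<open>auto simp: index_set_def\<close>)
  thus "is ! k = js ! k" using assms(4) by (auto split: if_splits)
qed

lemma row_index_surj:
  assumes "j < (\<Prod>k \<in> {..<length ds} - {n}. ds ! k)" and "i < ds ! n" and "n < length ds"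
  shows "\<exists>is \<in> index_set ds. row_index ds n is = j \<and> is ! n = i"
proof -
  obtain d where d: "\<forall>k<length ds. d k < (if k = n then 1 else ds ! k)"
    "(\<Sum>k<length ds. d k * (\<Prod>l<k. if l = n then 1 else ds ! l)) = j"
    using mixed_radix_surj[OF assms(1)[unfolded prod_skip]] by blast
  let ?is = "map (d(n := i)) [0..<length ds]"
  have "?is \<in> index_set ds" using d(1) assms by (auto simp: index_set_def)
  moreover have "row_index ds n ?is = j"
    unfolding row_index_radix d(2)[symmetric] using d(1) by (intro sum.cong) auto
  moreover have "?is ! n = i" using assms by simp
  ultimately show ?thesis by blast
qed

lemma dim_unfold_mat [simp]:
  "dim_row (unfold_mat A n) = (\<Prod>k \<in> {..<length (dims A)} - {n}. dims A ! k)"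
  "dim_col (unfold_mat A n) = dims A ! n"
  by (simp_all add: unfold_mat_def)

lemma unfold_entry:
  assumes "is \<in> index_set (dims A)" and "n < length (dims A)"
  shows "unfold_mat A n $$ (row_index (dims A) n is, is ! n) = entry A is"
proof -
  have "(THE js. js \<in> index_set (dims A) \<and> row_index (dims A) n js = row_index (dims A) n is
      \<and> js ! n = is ! n) = is"
    using assms by (intro the_equality) (auto intro: row_index_inj)
  moreover have "is ! n < dims A ! n" using assms by (simp add: index_set_def)
  ultimately show ?thesis
    unfolding unfold_mat_def using row_index_less[OF assms(1)] by simp
qed

lemma unfold_mode_prod:
  fixes D :: "'a :: comm_semiring_0 tensor"
  assumes n: "n < length (dims D)" and X: "dim_col X = dims D ! n"
  shows "unfold_mat (mode_prod D n X) n = unfold_mat D n * X\<^sup>T"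
proof (rule eq_matI)
  let ?ds = "(dims D)[n := dim_row X]"
  have rows: "(\<Prod>k \<in> {..<length ?ds} - {n}. ?ds ! k)
      = (\<Prod>k \<in> {..<length (dims D)} - {n}. dims D ! k)"
    by (intro prod.cong) auto
  show "dim_row (unfold_mat (mode_prod D n X) n) = dim_row (unfold_mat D n * X\<^sup>T)"
    using rows by (simp add: mode_prod_def)
  show "dim_col (unfold_mat (mode_prod D n X) n) = dim_col (unfold_mat D n * X\<^sup>T)"
    using n by (simp add: mode_prod_def)
  fix j i assume "j < dim_row (unfold_mat D n * X\<^sup>T)" and "i < dim_col (unfold_mat D n * X\<^sup>T)"
  hence j: "j < (\<Prod>k \<in> {..<length (dims D)} - {n}. dims D ! k)" and i: "i < dim_row X"
    by simp_all
  obtain "is" where "is": "is \<in> index_set ?ds" "row_index ?ds n is = j" "is ! n = i"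
    using row_index_surj[of j ?ds n i] j i n rows by auto
  have len: "length is = length (dims D)" using "is"(1) by (simp add: index_set_def)
  have row: "unfold_mat D n $$ (j, l) = entry D (is[n := l])" if l: "l < dims D ! n" for l
  proof -
    have "is[n := l] \<in> index_set (dims D)"
      using "is"(1) l n by (auto simp: index_set_def nth_list_update split: if_splits)
    moreover have "row_index (dims D) n (is[n := l]) = row_index ?ds n is"
      unfolding row_index_radix
      by (auto intro!: sum.cong prod.cong arg_cong2[where f = "(*)"] simp: nth_list_update)
    moreover have "is[n := l] ! n = l" using n len by simp
    ultimately show ?thesis using unfold_entry[of "is[n := l]" D n] n "is"(2) by simp
  qed
  have "unfold_mat (mode_prod D n X) n $$ (j, i) = entry (mode_prod D n X) is"
    using unfold_entry[of "is" "mode_prod D n X" n] "is" n by (simp add: mode_prod_def)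
  also have "\<dots> = (\<Sum>l < dim_col X. X $$ (i, l) * entry D (is[n := l]))"
    using "is" by (simp add: mode_prod_def)
  also have "\<dots> = (\<Sum>l < dim_col X. unfold_mat D n $$ (j, l) * X $$ (i, l))"
    using row X by (intro sum.cong) (auto simp: mult.commute)
  also have "\<dots> = (unfold_mat D n * X\<^sup>T) $$ (j, i)"
    using i j X by (simp add: scalar_prod_def atLeast0LessThan)
  finally show "unfold_mat (mode_prod D n X) n $$ (j, i) = (unfold_mat D n * X\<^sup>T) $$ (j, i)" .
qed

end

theory Submission
  imports Defs
begin

text \<open>
  Write \<open>A \<bullet>\<^sub>n X\<close> for the mode-\<open>n\<close> product.  The given decomposition of \<open>A\<close> is used only to see
  that its matrix representations have full column rank: the projection onto the \<open>r\<close>th block of columns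
  in a mode \<open>m \<noteq> n\<close> cuts the \<open>r\<close>th term out of \<open>A\<close>, so a vector killed by the mode-\<open>n\<close>
  representation of \<open>A\<close> is killed by that of every term.  From then on everything follows from
  \<open>A \<bullet>\<^sub>n M\<^sub>n\<^sup>T = B = A \<bullet>\<^sub>m M\<^sub>m\<^sup>T\<close> and the fact that products in different modes commute.
  Contracting mode \<open>n\<close> with an eigenvector of \<open>M\<^sub>n\<close> leaves a nonzero tensor whose mode-\<open>m\<close> fibers are
  left eigenvectors of \<open>M\<^sub>m\<close>, and diagonalizing the action in mode \<open>m\<close> turns all mode-\<open>n\<close> fibers into
  left eigenvectors of \<open>M\<^sub>n\<close>.  For the spectral projections \<open>P\<^sub>n\<^sub>,\<^sub>r = X\<^sub>n\<^sub>,\<^sub>r Y\<^sub>n\<^sub>,\<^sub>r\<close> of \<open>M\<^sub>n\<^sup>T\<close>, the mixed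
  products \<open>A \<bullet>\<^sub>m P\<^sub>m\<^sub>,\<^sub>r \<bullet>\<^sub>n P\<^sub>n\<^sub>,\<^sub>s\<close> with \<open>r \<noteq> s\<close> vanish, because they are scaled by both \<open>\<lambda>\<^sub>r\<close> and
  \<open>\<lambda>\<^sub>s\<close>.  Hence \<open>A \<bullet>\<^sub>n P\<^sub>n\<^sub>,\<^sub>r\<close> does not depend on \<open>n\<close>; it is the \<open>r\<close>th term, and its core is the
  product of \<open>A\<close> with the \<open>Y\<^sub>n\<^sub>,\<^sub>r\<close> in all modes.
\<close>

section \<open>Injective matrices and rank\<close>

text \<open>Full column rank, encoded as a trivial kernel because in that form it cancels on the
  left directly; \<open>mat_rank_inj\<close> and \<open>inj_mat_of_rank\<close> translate to and
  from \<open>mat_rank\<close>.\<close>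

definition inj_mat :: "'a :: field mat \<Rightarrow> bool" where
  "inj_mat A \<longleftrightarrow> (\<forall>v \<in> carrier_vec (dim_col A). A *\<^sub>v v = 0\<^sub>v (dim_row A) \<longrightarrow> v = 0\<^sub>v (dim_col A))"

lemma inj_matI:
  assumes "A \<in> carrier_mat nr nc"
    and "\<And>v. v \<in> carrier_vec nc \<Longrightarrow> A *\<^sub>v v = 0\<^sub>v nr \<Longrightarrow> v = 0\<^sub>v nc"
  shows "inj_mat A"
  using assms unfolding inj_mat_def by auto

lemma inj_matD:
  assumes "inj_mat A" "A \<in> carrier_mat nr nc" "v \<in> carrier_vec nc" "A *\<^sub>v v = 0\<^sub>v nr"
  shows "v = 0\<^sub>v nc"
  using assms unfolding inj_mat_def by auto

lemma index_mult_mat_sum: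
  assumes "A \<in> carrier_mat nr n" "B \<in> carrier_mat n nc" "i < nr" "j < nc"
  shows "(A * B) $$ (i, j) = (\<Sum>l<n. A $$ (i, l) * B $$ (l, j))"
  using assms by (simp add: scalar_prod_def atLeast0LessThan)

lemma inj_mat_cancel:
  assumes inj: "inj_mat A" and A: "A \<in> carrier_mat nr nc"
    and v: "v \<in> carrier_vec nc" and w: "w \<in> carrier_vec nc" and eq: "A *\<^sub>v v = A *\<^sub>v w"
  shows "v = w"
proof -
  have "A *\<^sub>v (v - w) = 0\<^sub>v nr"
    using A v w eq by (simp add: mult_minus_distrib_mat_vec[OF A v w])
  hence "v - w = 0\<^sub>v nc" using inj_matD[OF inj A] v w by simp
  thus ?thesis using v w
    by (intro eq_vecI) (auto simp: vec_eq_iff)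
qed

lemma inj_mat_mult_cancel:
  assumes inj: "inj_mat A" and A: "A \<in> carrier_mat nr nc"
    and X: "X \<in> carrier_mat nc k" and Y: "Y \<in> carrier_mat nc k" and eq: "A * X = A * Y"
  shows "X = Y"
proof (rule mat_col_eqI)
  fix j assume "j < dim_col Y"
  hence j: "j < k" using Y by simp
  have "A *\<^sub>v col X j = A *\<^sub>v col Y j"
    using eq j col_mult2[OF A X j] col_mult2[OF A Y j] by simp
  thus "col X j = col Y j" using inj_mat_cancel[OF inj A] X Y j by auto
qed (use X Y in auto)

lemma inj_mat_left_inverse:
  assumes Y: "Y \<in> carrier_mat nc nr" and A: "A \<in> carrier_mat nr nc" and inv: "Y * A = 1\<^sub>m nc"
  shows "inj_mat A"
proof (rule inj_matI[OF A])
  fix v assume v: "v \<in> carrier_vec nc" and z: "A *\<^sub>v v = 0\<^sub>v nr"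
  have "v = (Y * A) *\<^sub>v v" using v inv by simp
  also have "\<dots> = Y *\<^sub>v (A *\<^sub>v v)" using Y A v by simp
  finally show "v = 0\<^sub>v nc" using z Y by auto
qed

lemma inj_mat_mult:
  assumes "inj_mat A" "inj_mat B" and A: "A \<in> carrier_mat nr n" and B: "B \<in> carrier_mat n nc"
  shows "inj_mat (A * B)"
proof (rule inj_matI)
  show "A * B \<in> carrier_mat nr nc" using A B by simp
  fix v assume v: "v \<in> carrier_vec nc" and z: "(A * B) *\<^sub>v v = 0\<^sub>v nr"
  hence "A *\<^sub>v (B *\<^sub>v v) = 0\<^sub>v nr" using A B by simp
  hence "B *\<^sub>v v = 0\<^sub>v n" using inj_matD[OF assms(1) A] B v by simp
  thus "v = 0\<^sub>v nc" using inj_matD[OF assms(2) B v] by simp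
qed

section \<open>Ranks of injective matrices and of products\<close>

lemma mat_rank_inj:
  assumes inj: "inj_mat A" and A: "A \<in> carrier_mat nr nc"
  shows "mat_rank A = nc"
proof -
  interpret vec_space "TYPE('a)" nr .
  \<comment> \<open>Independence concerns the set of columns, so repetitions have to be excluded
    first: two equal columns would be equal images of different unit vectors.\<close>
  have dist: "distinct (cols A)"
  proof (rule distinct_conv_nth[THEN iffD2], intro allI impI)
    fix i j assume ij: "i < length (cols A)" "j < length (cols A)" "i \<noteq> j"
    hence i: "i < nc" and j: "j < nc" using A by auto
    have "unit_vec nc i \<noteq> (unit_vec nc j :: 'a vec)" using ij(3) i j by (metis index_unit_vec(1) zero_neq_one)
    moreover have "A *\<^sub>v unit_vec nc i = col A i" "A *\<^sub>v unit_vec nc j = col A j"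
      using A i j by (intro eq_vecI; simp)+
    ultimately show "cols A ! i \<noteq> cols A ! j"
      using inj_mat_cancel[OF inj A, of "unit_vec nc i" "unit_vec nc j"] i j A by auto
  qed
  have "lin_indpt (set (cols A))"
    using lin_depE[OF A _ dist] inj_matD[OF inj A] by metis
  thus ?thesis using lin_indpt_full_rank[OF A dist] A unfolding mat_rank_def by auto
qed

text \<open>The column space of the product lies in that of the left factor, and dimension is
  monotone on subspaces.\<close>

lemma mat_rank_mono:
  assumes A: "A \<in> carrier_mat nr nc" and B: "B \<in> carrier_mat nc m"
  shows "mat_rank (A * B) \<le> mat_rank A"
proof -
  interpret vec_space "TYPE('a)" nr .
  have AB: "A * B \<in> carrier_mat nr m" using A B by simp
  have "col_space (A * B) \<subseteq> col_space A"
  proof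
    fix y assume "y \<in> col_space (A * B)"
    then obtain x where x: "x \<in> carrier_vec m" and y: "y = A * B *\<^sub>v x"
      unfolding col_space_eq[OF AB] using B by auto
    hence "y = A *\<^sub>v (B *\<^sub>v x)" using A B by simp
    moreover have "B *\<^sub>v x \<in> carrier_vec nc" using B x by simp
    ultimately show "y \<in> col_space A" unfolding col_space_eq[OF A] using A by auto
  qed
  hence sub: "span (set (cols (A * B))) \<subseteq> span (set (cols A))" by (simp add: col_space_def)
  have sA: "set (cols A) \<subseteq> carrier_vec nr" and sAB: "set (cols (A * B)) \<subseteq> carrier_vec nr"
    using A AB cols_dim by blast+
  have vs: "vectorspace class_ring (span_vs (set (cols A)))"
    using span_is_subspace[THEN subspace_is_vs, of "set (cols A)"] sA by simp
  have "VectorSpace.subspace class_ring (span (set (cols (A * B)))) (span_vs (set (cols A)))"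
    using nested_subspaces[OF span_is_subspace span_is_subspace sub] sA sAB by simp
  from vectorspace.subspace_dim[OF vs this] fin_dim_span_cols[OF A] fin_dim_span_cols[OF AB]
  have "rank (A * B) \<le> rank A" unfolding rank_def by simp
  thus ?thesis using A AB unfolding mat_rank_def by auto
qed

text \<open>Neither right multiplication can raise the rank, and multiplying by \<open>C\<close>
  brings \<open>A * B\<close> back to \<open>A\<close>.\<close>

lemma mat_rank_mult_right_inverse:
  assumes A: "A \<in> carrier_mat nr nc" and B: "B \<in> carrier_mat nc m" and C: "C \<in> carrier_mat m nc"
    and inv: "B * C = 1\<^sub>m nc"
  shows "mat_rank (A * B) = mat_rank A"
proof (rule antisym)
  show "mat_rank (A * B) \<le> mat_rank A" by (rule mat_rank_mono[OF A B])
  have "mat_rank (A * B * C) \<le> mat_rank (A * B)"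
    by (rule mat_rank_mono[of _ nr m _ nc]) (use A B C in auto)
  also have "A * B * C = A" using A B C inv by (metis assoc_mult_mat right_mult_one_mat)
  finally show "mat_rank A \<le> mat_rank (A * B)" .
qed

text \<open>A maximal independent set of columns has \<open>nc\<close> elements, which forces the
  \<open>nc\<close> columns to be distinct and independent; a nonzero kernel vector would be a
  dependency among them.\<close>

lemma inj_mat_of_rank:
  assumes A: "A \<in> carrier_mat nr nc" and rk: "nc \<le> mat_rank A"
  shows "inj_mat A"
proof (rule inj_matI[OF A], rule ccontr)
  interpret vec_space "TYPE('a)" nr .
  fix v assume v: "v \<in> carrier_vec nc" "A *\<^sub>v v = 0\<^sub>v nr" "v \<noteq> 0\<^sub>v nc"
  have r: "mat_rank A = rank A" using A by (simp add: mat_rank_def)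
  have rk': "rank A = nc" using rank_le_nc[OF A] rk r by simp
  obtain S where S: "maximal S (\<lambda>T. T \<subseteq> set (cols A) \<and> lin_indpt T)"
    using maximal_exists[of "(\<lambda>T. T \<subseteq> set (cols A) \<and> lin_indpt T)" "card (set (cols A))" "{}"]
    by (meson List.finite_set card_mono empty_iff empty_subsetI finite_lin_indpt2 rev_finite_subset)
  have "card S = nc" using rank_card_indpt[OF A S] rk' by simp
  moreover have "card S \<le> card (set (cols A))" using S by (simp add: card_mono maximal_def)
  ultimately have "distinct (cols A)"
    using A card_length[of "cols A"] by (intro card_distinct) auto
  thus False using lin_depI[OF A v(1,3,2)] full_rank_lin_indpt[OF A rk'] by simp
qed

lemma mat_rank_zero: "mat_rank (0\<^sub>m nr nc :: 'a :: field mat) = 0"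
proof -
  interpret vec_space "TYPE('a)" nr .
  show ?thesis using rank_0I by (simp add: mat_rank_def)
qed

text \<open>Two columns of a rank-one matrix satisfy a nontrivial linear relation, which makes every
  2 by 2 minor vanish. Equal columns are treated separately because as a set they are only one
  vector.\<close>

lemma mat_rank_one_minor:
  fixes A :: "'a :: field mat"
  assumes A: "A \<in> carrier_mat nr nc" and rk: "mat_rank A = 1"
    and "i < nr" "i' < nr" "j < nc" "j' < nc"
  shows "A $$ (i, j) * A $$ (i', j') = A $$ (i, j') * A $$ (i', j)"
proof (cases "col A j = col A j'")
  case True
  hence "A $$ (k, j) = A $$ (k, j')" if "k < nr" for k
    using that assms A by (metis carrier_matD index_col)
  thus ?thesis using assms by simp
next
  case False
  interpret vec_space "TYPE('a)" nr .
  let ?B = "mat_of_cols nr [col A j, col A j']"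
  have c: "cols ?B = [col A j, col A j']" using A by (intro cols_mat_of_cols) auto
  have B: "?B \<in> carrier_mat nr 2" by (simp add: mat_of_cols_def numeral_2_eq_2)
  have "\<not> lin_indpt (set (cols ?B))"
  proof
    assume li: "lin_indpt (set (cols ?B))"
    have "set (cols ?B) \<subseteq> set (cols A)" unfolding c using assms A by (auto simp: cols_def)
    from rank_ge_card_indpt[OF A this li] show False
      using False rk A by (simp add: c mat_rank_def)
  qed
  then obtain v where v: "v \<in> carrier_vec 2" "v \<noteq> 0\<^sub>v 2" "?B *\<^sub>v v = 0\<^sub>v nr"
    using lin_depE[OF B] c False by (metis distinct_length_2_or_more distinct_singleton)
  have rel: "A $$ (k, j) * v $ 0 + A $$ (k, j') * v $ 1 = 0" if k: "k < nr" for k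
  proof -
    have "(?B *\<^sub>v v) $ k = 0" using v k by simp
    thus ?thesis using k A assms v(1)
      by (simp add: scalar_prod_def mat_of_cols_index numeral_2_eq_2)
  qed
  have "v $ 0 \<noteq> 0 \<or> v $ 1 \<noteq> 0"
  proof (rule ccontr)
    assume "\<not> ?thesis"
    hence "v = 0\<^sub>v 2" using v(1) by (intro eq_vecI) (auto simp: less_2_cases_iff)
    with v(2) show False by simp
  qed
  \<comment> \<open>The minor times either coefficient is a combination of the relations in rows
    \<open>i\<close> and \<open>i'\<close>, and one of the two coefficients is nonzero.\<close>
  moreover have "(A $$ (i, j) * A $$ (i', j') - A $$ (i, j') * A $$ (i', j)) * v $ 0 =
      A $$ (i', j') * (A $$ (i, j) * v $ 0 + A $$ (i, j') * v $ 1)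
      - A $$ (i, j') * (A $$ (i', j) * v $ 0 + A $$ (i', j') * v $ 1)"
    by (simp add: algebra_simps)
  moreover have "(A $$ (i, j) * A $$ (i', j') - A $$ (i, j') * A $$ (i', j)) * v $ 1 =
      A $$ (i, j) * (A $$ (i', j) * v $ 0 + A $$ (i', j') * v $ 1)
      - A $$ (i', j) * (A $$ (i, j) * v $ 0 + A $$ (i, j') * v $ 1)"
    by (simp add: algebra_simps)
  ultimately show ?thesis using rel[OF \<open>i < nr\<close>] rel[OF \<open>i' < nr\<close>] by auto
qed

section \<open>Diagonalizability and eigenvalues from left eigenvectors\<close>

text \<open>A nonzero row of \<open>U\<close> is an eigenvector of the transpose of
  \<open>M\<close>, and a matrix and its transpose have the same characteristic polynomial.\<close>

lemma eigenvalue_of_left_eigenvector: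
  fixes M :: "'a :: field mat"
  assumes M: "M \<in> carrier_mat n n" and U: "U \<in> carrier_mat m n"
    and eq: "U * M = c \<cdot>\<^sub>m U" and nz: "U \<noteq> 0\<^sub>m m n"
  shows "c \<in> spectrum M"
proof -
  have "\<exists>i < m. row U i \<noteq> 0\<^sub>v n"
  proof (rule ccontr)
    assume "\<not> ?thesis"
    hence "U = 0\<^sub>m m n" using U by (intro eq_rowI) auto
    with nz show False by simp
  qed
  then obtain i where i: "i < m" "row U i \<noteq> 0\<^sub>v n" by blast
  have "M\<^sup>T *\<^sub>v row U i = row (U * M) i"
    using U M i by (intro eq_vecI) (auto simp: comm_scalar_prod[of _ n])
  also have "\<dots> = c \<cdot>\<^sub>v row U i" using eq U i by (auto intro!: eq_vecI)
  finally have "eigenvalue M\<^sup>T c"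
    unfolding eigenvalue_def eigenvector_def using i U M by (intro exI[of _ "row U i"]) auto
  hence "poly (char_poly M\<^sup>T) c = 0"
    using eigenvalue_root_char_poly[of "M\<^sup>T" n c] M by simp
  thus ?thesis using spectrum_root_char_poly[OF M] M by simp
qed

text \<open>Injectivity of \<open>U\<close> makes its rows span the whole space, so a basis can be
  chosen among these left eigenvectors; it forms the rows of a matrix \<open>Q\<close> with
  \<open>Q * M = D * Q\<close>.\<close>

lemma diagonalizable_of_left_eigenvectors:
  fixes M :: "'a :: field mat"
  assumes inj: "inj_mat U" and U: "U \<in> carrier_mat m n" and M: "M \<in> carrier_mat n n"
    and ev: "\<And>i. i < m \<Longrightarrow> M\<^sup>T *\<^sub>v row U i = d i \<cdot>\<^sub>v row U i"
  shows "diagonalizable_mat M"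
proof -
  interpret vec_space "TYPE('a)" n .
  have sU: "set (rows U) \<subseteq> carrier_vec n" using U rows_carrier[of U] by auto
  obtain S where S: "maximal S (\<lambda>T. T \<subseteq> set (rows U) \<and> lin_indpt T)" and fS: "finite S"
    using maximal_exists_superset[of "set (rows U)" "\<lambda>T. T \<subseteq> set (rows U) \<and> lin_indpt T" "{}"]
      finite_lin_indpt2[of "{}"] by auto
  have li: "lin_indpt S" and SU: "S \<subseteq> set (rows U)" using S by (auto simp: maximal_def)
  have SV: "S \<subseteq> carrier_vec n" using SU sU by auto
  have spn: "set (rows U) \<subseteq> span S"
  proof
    fix u assume u: "u \<in> set (rows U)"
    show "u \<in> span S"
    proof (rule ccontr)
      assume nu: "u \<notin> span S"
      hence "u \<notin> S" using SV span_mem by auto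
      moreover have "lin_indpt (insert u S)"
        using lin_dep_iff_in_span[of S u] SV li u sU \<open>u \<notin> S\<close> nu by (simp add: subset_iff)
      ultimately show False using S u SU unfolding maximal_def by blast
    qed
  qed
  obtain xs where xs: "set xs = S" "distinct xs" using finite_distinct_list[OF fS] by blast
  have len: "length xs \<le> n"
    using li_le_dim(2)[OF fin_dim _ li] SV dim_is_n xs distinct_card[of xs] by simp
  \<comment> \<open>Zero rows make \<open>Q\<close> square before the basis is known to have
    \<open>n\<close> elements; the nonvanishing determinant below implies that none is actually
    added.\<close>
  define ys where "ys = xs @ replicate (n - length xs) (0\<^sub>v n)"
  define Q where "Q = mat_of_rows n ys"
  have lys: "length ys = n" using len by (simp add: ys_def)
  have ysV: "set ys \<subseteq> carrier_vec n" using xs SV by (auto simp: ys_def)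
  have Q: "Q \<in> carrier_mat n n" unfolding Q_def using lys by (simp add: mat_of_rows_def)
  have rowQ: "row Q i = ys ! i" if "i < n" for i
    using that lys ysV unfolding Q_def by (intro mat_of_rows_row) auto
  have det: "det Q \<noteq> 0"
  proof
    assume "det Q = 0"
    then obtain v where v: "v \<in> carrier_vec n" "v \<noteq> 0\<^sub>v n" "Q *\<^sub>v v = 0\<^sub>v n"
      using det_0_iff_vec_prod_zero_field[OF Q] by auto
    \<comment> \<open>A kernel vector of \<open>Q\<close> is orthogonal, for the scalar product
      without conjugation, to \<open>S\<close> and so to its span, which contains all rows of
      \<open>U\<close>; injectivity of \<open>U\<close> then gives \<open>v = 0\<close>.\<close>
    have "v \<in> orthogonal_complement S"
      unfolding orthogonal_complement_def
    proof (intro CollectI conjI ballI)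
      fix y assume "y \<in> S"
      then obtain i where i: "i < length xs" "y = xs ! i" using xs by (metis in_set_conv_nth)
      hence "row Q i = y" "i < n" using rowQ[of i] len by (auto simp: ys_def nth_append)
      moreover have "(Q *\<^sub>v v) $ i = 0" using v \<open>i < n\<close> by simp
      ultimately have "y \<bullet> v = 0" using Q by simp
      thus "v \<bullet> y = 0" using comm_scalar_prod[of v n y] v \<open>y \<in> S\<close> SV by auto
    qed (use v in auto)
    hence "v \<in> orthogonal_complement (span S)" using in_orthogonal_complement_span[OF SV] by simp
    hence orth: "v \<bullet> u = 0" if "u \<in> set (rows U)" for u
      using that spn by (auto simp: orthogonal_complement_def)
    have "U *\<^sub>v v = 0\<^sub>v m"
    proof (rule eq_vecI)
      fix i assume "i < dim_vec (0\<^sub>v m)"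
      hence i: "i < m" by simp
      hence "row U i \<in> set (rows U)" using U by (auto simp: rows_def)
      hence "row U i \<bullet> v = 0" using orth comm_scalar_prod[of v n "row U i"] v U i by auto
      thus "(U *\<^sub>v v) $ i = 0\<^sub>v m $ i" using i U by simp
    qed (use U in auto)
    thus False using inj_matD[OF inj U v(1)] v(2) by simp
  qed
  have "\<exists>e. M\<^sup>T *\<^sub>v (ys ! i) = e \<cdot>\<^sub>v (ys ! i)" if i: "i < n" for i
  proof (cases "i < length xs")
    case True
    hence "ys ! i \<in> set (rows U)" using xs SU by (auto simp: ys_def nth_append)
    then obtain k where "k < m" "ys ! i = row U k" using U by (auto simp: rows_def)
    thus ?thesis using ev by auto
  next
    case False
    hence "ys ! i = 0\<^sub>v n" using i len by (simp add: ys_def nth_append)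
    \<comment> \<open>A padding row satisfies the equation with any scalar; \<open>0\<close> is
      taken.\<close>
    thus ?thesis using M by (intro exI[of _ 0]) (auto intro!: eq_vecI)
  qed
  then obtain e where e: "\<And>i. i < n \<Longrightarrow> M\<^sup>T *\<^sub>v (ys ! i) = e i \<cdot>\<^sub>v (ys ! i)" by metis
  define D where "D = mat n n (\<lambda>(i, j). if i = j then e i else 0)"
  have D: "D \<in> carrier_mat n n" by (simp add: D_def)
  have QM: "Q * M = D * Q"
  proof (rule eq_matI)
    fix i j assume "i < dim_row (D * Q)" "j < dim_col (D * Q)"
    hence i: "i < n" and j: "j < n" using D Q by auto
    have "(Q * M) $$ (i, j) = (M\<^sup>T *\<^sub>v row Q i) $ j"
      using Q M i j comm_scalar_prod[of "row Q i" n "col M j"] by simp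
    also have "\<dots> = e i * Q $$ (i, j)"
      using rowQ[OF i] e[OF i] i j Q by (metis carrier_matD(1,2) index_row(1) index_row(2) index_smult_vec(1))
    also have "\<dots> = (\<Sum>k<n. if k = i then e i * Q $$ (k, j) else 0)" using i by simp
    also have "\<dots> = (\<Sum>k<n. D $$ (i, k) * Q $$ (k, j))"
      using i by (intro sum.cong) (auto simp: D_def)
    also have "\<dots> = (D * Q) $$ (i, j)"
      using i j Q D by (simp add: scalar_prod_def atLeast0LessThan)
    finally show "(Q * M) $$ (i, j) = (D * Q) $$ (i, j)" .
  qed (use Q M D in auto)
  obtain P where P: "P \<in> carrier_mat n n" "P * Q = 1\<^sub>m n" "Q * P = 1\<^sub>m n"
    using det_non_zero_imp_unit[OF Q det, of "()"] by (auto simp: Units_def ring_mat_def)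
  have "M = P * Q * M" using P M by simp
  also have "\<dots> = P * (Q * M)" using P Q M by (intro assoc_mult_mat) auto
  also have "\<dots> = P * D * Q" unfolding QM using P D Q by (intro assoc_mult_mat[symmetric]) auto
  finally have "similar_mat M D"
    using P Q M D by (intro similar_matI[of _ _ P Q n]) auto
  moreover have "diagonal_mat D" by (auto simp: diagonal_mat_def D_def)
  ultimately show ?thesis unfolding diagonalizable_mat_def by blast
qed

section \<open>Algebra of mode products\<close>

lemma index_set_length: "is \<in> index_set ds \<Longrightarrow> length is = length ds"
  by (simp add: index_set_def)

lemma index_set_nth: "is \<in> index_set ds \<Longrightarrow> n < length ds \<Longrightarrow> is ! n < ds ! n"
  by (simp add: index_set_def)

lemma index_set_update:
  assumes "is \<in> index_set (ds[n := a])" "l < ds ! n"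
  shows "is[n := l] \<in> index_set ds"
proof -
  have "is[n := l] ! k < ds ! k" if "k < length ds" for k
    using assms that by (cases "k = n") (auto simp: index_set_def)
  thus ?thesis using assms by (simp add: index_set_def)
qed

lemma index_set_update_other:
  assumes "is \<in> index_set ds" "l < b"
  shows "is[n := l] \<in> index_set (ds[n := b])"
proof -
  have "is[n := l] ! k < ds[n := b] ! k" if "k < length ds" for k
    using assms that by (cases "k = n") (auto simp: index_set_def)
  thus ?thesis using assms by (simp add: index_set_def)
qed

lemma dims_mode_prod [simp]: "dims (mode_prod D n X) = (dims D)[n := dim_row X]"
  by (simp add: mode_prod_def)

lemma entry_mode_prod:
  assumes "is \<in> index_set ((dims D)[n := dim_row X])"
  shows "entry (mode_prod D n X) is = (\<Sum>l < dim_col X. X $$ (is ! n, l) * entry D (is[n := l]))"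
  using assms by (simp add: mode_prod_def)

text \<open>Both sides are the same double sum over the two contracted indices, taken in opposite
  order.\<close>

lemma mode_prod_commute:
  fixes D :: "'a :: comm_semiring_0 tensor"
  assumes mn: "m \<noteq> n" and X: "dim_col X = dims D ! n" and Y: "dim_col Y = dims D ! m"
  shows "mode_prod (mode_prod D n X) m Y = mode_prod (mode_prod D m Y) n X"
proof (rule tensor_eqI)
  show "dims (mode_prod (mode_prod D n X) m Y) = dims (mode_prod (mode_prod D m Y) n X)"
    using mn by (simp add: list_update_swap)
  \<comment> \<open>The modes and matrices are generalized here so that one expansion serves both
    sides.\<close>
  have half: "entry (mode_prod (mode_prod D n X) m Y) is =
      (\<Sum>l<dim_col Y. \<Sum>k<dim_col X. Y $$ (is ! m, l) * (X $$ (is ! n, k) * entry D (is[m := l, n := k])))"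
    if "is": "is \<in> index_set ((dims D)[n := dim_row X, m := dim_row Y])" and nm: "m \<noteq> n"
      and Y: "dim_col Y = dims D ! m"
    for "is" n m and X Y :: "'a mat"
  proof -
    have "is[m := l] \<in> index_set ((dims D)[n := dim_row X])" if "l < dim_col Y" for l
      using index_set_update[OF "is"] that Y nm by simp
    thus ?thesis using "is" nm
      by (auto simp: entry_mode_prod sum_distrib_left intro!: sum.cong)
  qed
  fix "is" assume "is \<in> index_set (dims (mode_prod (mode_prod D n X) m Y))"
  hence is1: "is \<in> index_set ((dims D)[n := dim_row X, m := dim_row Y])"
    and is2: "is \<in> index_set ((dims D)[m := dim_row Y, n := dim_row X])"
    using mn by (simp_all add: list_update_swap)
  show "entry (mode_prod (mode_prod D n X) m Y) is = entry (mode_prod (mode_prod D m Y) n X) is"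
    unfolding half[OF is1 mn Y] half[OF is2 mn[symmetric] X]
    using mn by (subst sum.swap) (simp add: list_update_swap mult.left_commute)
qed

text \<open>The factor applied later stands on the left, as for the composition of linear maps on
  the fibers.\<close>

lemma mode_prod_mult:
  fixes D :: "'a :: comm_semiring_0 tensor"
  assumes n: "n < length (dims D)" and X: "dim_col X = dims D ! n" and Y: "dim_col Y = dim_row X"
  shows "mode_prod (mode_prod D n X) n Y = mode_prod D n (Y * X)"
proof (rule tensor_eqI)
  fix "is" assume "is \<in> index_set (dims (mode_prod (mode_prod D n X) n Y))"
  hence "is": "is \<in> index_set ((dims D)[n := dim_row Y])" by simp
  have len: "length is = length (dims D)" using index_set_length[OF "is"] by simp
  have isn: "is ! n < dim_row Y" using index_set_nth[OF "is", of n] n by simp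
  have upd: "is[n := l] \<in> index_set ((dims D)[n := dim_row X])" if "l < dim_col Y" for l
    using index_set_update[of "is" "(dims D)[n := dim_row X]" n "dim_row Y" l] "is" that Y n by simp
  have "entry (mode_prod (mode_prod D n X) n Y) is =
      (\<Sum>l<dim_col Y. \<Sum>k<dim_col X. Y $$ (is ! n, l) * (X $$ (l, k) * entry D (is[n := k])))"
    using "is" upd n len by (auto simp: entry_mode_prod sum_distrib_left intro!: sum.cong)
  also have "\<dots> = (\<Sum>k<dim_col X. (\<Sum>l<dim_col Y. Y $$ (is ! n, l) * X $$ (l, k)) * entry D (is[n := k]))"
    by (subst sum.swap) (simp add: sum_distrib_right mult.assoc)
  also have "\<dots> = (\<Sum>k<dim_col X. (Y * X) $$ (is ! n, k) * entry D (is[n := k]))"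
    using isn Y by (intro sum.cong) (auto simp: scalar_prod_def atLeast0LessThan)
  also have "\<dots> = entry (mode_prod D n (Y * X)) is"
    using "is" by (simp add: entry_mode_prod)
  finally show "entry (mode_prod (mode_prod D n X) n Y) is = entry (mode_prod D n (Y * X)) is" .
qed simp

lemma mode_prod_one:
  fixes D :: "'a :: comm_semiring_1 tensor"
  assumes n: "n < length (dims D)"
  shows "mode_prod D n (1\<^sub>m (dims D ! n)) = D"
proof (rule tensor_eqI)
  fix "is" assume "is \<in> index_set (dims (mode_prod D n (1\<^sub>m (dims D ! n))))"
  hence "is": "is \<in> index_set (dims D)" by simp
  have isn: "is ! n < dims D ! n" using index_set_nth[OF "is" n] .
  have "entry (mode_prod D n (1\<^sub>m (dims D ! n))) is =
      (\<Sum>l<dims D ! n. 1\<^sub>m (dims D ! n) $$ (is ! n, l) * entry D (is[n := l]))"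
    using "is" by (simp add: entry_mode_prod)
  also have "\<dots> = (\<Sum>l<dims D ! n. if l = is ! n then entry D is else 0)"
    using isn by (intro sum.cong) auto
  finally have "entry (mode_prod D n (1\<^sub>m (dims D ! n))) is =
      (\<Sum>l<dims D ! n. if l = is ! n then entry D is else 0)" .
  thus "entry (mode_prod D n (1\<^sub>m (dims D ! n))) is = entry D is" using isn by simp
qed simp

text \<open>Linearity in the matrix. It is applied with coefficients \<open>1\<close> to a
  resolution of the identity, and with the eigenvalues to a spectral decomposition.\<close>

lemma entry_mode_prod_sum:
  fixes D :: "'a :: comm_semiring_0 tensor"
  assumes n: "n < length (dims D)" and X: "X \<in> carrier_mat a b"
    and P: "\<And>r. r < R \<Longrightarrow> P r \<in> carrier_mat a b"
    and eq: "\<And>i j. i < a \<Longrightarrow> j < b \<Longrightarrow> X $$ (i, j) = (\<Sum>r<R. c r * P r $$ (i, j))"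
    and "is": "is \<in> index_set ((dims D)[n := a])"
  shows "entry (mode_prod D n X) is = (\<Sum>r<R. c r * entry (mode_prod D n (P r)) is)"
proof -
  have isn: "is ! n < a" using index_set_nth[OF "is", of n] n by simp
  have "entry (mode_prod D n X) is = (\<Sum>l<b. \<Sum>r<R. c r * (P r $$ (is ! n, l) * entry D (is[n := l])))"
    using "is" X isn eq by (simp add: entry_mode_prod sum_distrib_right mult.assoc)
  also have "\<dots> = (\<Sum>r<R. c r * (\<Sum>l<b. P r $$ (is ! n, l) * entry D (is[n := l])))"
    by (subst sum.swap) (simp add: sum_distrib_left)
  also have "\<dots> = (\<Sum>r<R. c r * entry (mode_prod D n (P r)) is)"
  proof (rule sum.cong)
    fix r assume "r \<in> {..<R}"
    hence "dim_row (P r) = a" "dim_col (P r) = b" using P by auto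
    thus "c r * (\<Sum>l<b. P r $$ (is ! n, l) * entry D (is[n := l])) = c r * entry (mode_prod D n (P r)) is"
      using "is" by (simp add: entry_mode_prod)
  qed simp
  finally show ?thesis .
qed

lemma entry_mode_prod_tensor_sum:
  fixes T :: "nat \<Rightarrow> 'a :: comm_semiring_0 tensor"
  assumes T: "\<And>r. r < R \<Longrightarrow> dims (T r) = ds" and X: "dim_col X = ds ! n"
    and "is": "is \<in> index_set (ds[n := dim_row X])"
  shows "entry (mode_prod (tensor_sum ds R T) n X) is = (\<Sum>r<R. entry (mode_prod (T r) n X) is)"
proof -
  have upd: "is[n := l] \<in> index_set ds" if "l < dim_col X" for l
    using index_set_update[OF "is"] that X by simp
  have "entry (mode_prod (tensor_sum ds R T) n X) is =
      (\<Sum>l<dim_col X. \<Sum>r<R. X $$ (is ! n, l) * entry (T r) (is[n := l]))"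
    using "is" upd by (simp add: entry_mode_prod tensor_sum_def sum_distrib_left)
  also have "\<dots> = (\<Sum>r<R. entry (mode_prod (T r) n X) is)"
    using "is" T by (subst sum.swap) (simp add: entry_mode_prod)
  finally show ?thesis .
qed

section \<open>Scalar multiples and zero tensors under mode products\<close>

lemma tensor_scale_eq:
  assumes "dims S = dims T" "\<And>is. is \<in> index_set (dims T) \<Longrightarrow> entry S is = c * entry T is"
  shows "S = tensor_scale c T"
  using assms by (intro tensor_eqI) (auto simp: tensor_scale_def)

lemma mode_prod_smult:
  fixes D :: "'a :: comm_semiring_0 tensor"
  assumes n: "n < length (dims D)"
  shows "mode_prod D n (c \<cdot>\<^sub>m X) = tensor_scale c (mode_prod D n X)"
proof (rule tensor_scale_eq)
  fix "is" assume "is \<in> index_set (dims (mode_prod D n X))"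
  hence "is": "is \<in> index_set ((dims D)[n := dim_row X])" by simp
  moreover have "is ! n < dim_row X" using index_set_nth[OF "is", of n] n by simp
  ultimately show "entry (mode_prod D n (c \<cdot>\<^sub>m X)) is = c * entry (mode_prod D n X) is"
    by (simp add: entry_mode_prod sum_distrib_left mult.assoc)
qed simp

lemma mode_prod_zero:
  fixes D :: "'a :: comm_semiring_0 tensor"
  assumes n: "n < length (dims D)"
  shows "mode_prod D n (0\<^sub>m a b) = tensor ((dims D)[n := a]) (\<lambda>_. 0)"
proof (rule tensor_eqI)
  fix "is" assume "is \<in> index_set (dims (mode_prod D n (0\<^sub>m a b)))"
  hence "is": "is \<in> index_set ((dims D)[n := a])" by simp
  moreover have "is ! n < a" using index_set_nth[OF "is", of n] n by simp
  ultimately show "entry (mode_prod D n (0\<^sub>m a b)) is = entry (tensor ((dims D)[n := a]) (\<lambda>_. 0)) is"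
    by (simp add: entry_mode_prod)
qed simp

lemma mode_prod_of_zero:
  assumes X: "dim_col X = ds ! n"
  shows "mode_prod (tensor ds (\<lambda>_. 0 :: 'a :: comm_semiring_0)) n X = tensor (ds[n := dim_row X]) (\<lambda>_. 0)"
proof (rule tensor_eqI)
  fix "is" assume "is \<in> index_set (dims (mode_prod (tensor ds (\<lambda>_. 0)) n X))"
  hence "is": "is \<in> index_set (ds[n := dim_row X])" by simp
  have "is[n := l] \<in> index_set ds" if "l < dim_col X" for l
    using index_set_update[OF "is"] that X by simp
  thus "entry (mode_prod (tensor ds (\<lambda>_. 0)) n X) is = entry (tensor (ds[n := dim_row X]) (\<lambda>_. 0)) is"
    using "is" by (simp add: entry_mode_prod)
qed simp

section \<open>Unfoldings\<close>

lemma unfold_mat_index: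
  assumes "n < length (dims A)" "j < dim_row (unfold_mat A n)" "i < dims A ! n"
  obtains "is" where "is \<in> index_set (dims A)" "is ! n = i" "row_index (dims A) n is = j"
    "unfold_mat A n $$ (j, i) = entry A is"
proof -
  obtain "is" where "is": "is \<in> index_set (dims A)" "row_index (dims A) n is = j" "is ! n = i"
    using row_index_surj[of j "dims A" n i] assms by auto
  with unfold_entry[OF "is"(1) assms(1)] that show ?thesis by blast
qed

lemma unfold_carrier: "unfold_mat A n \<in> carrier_mat (dim_row (unfold_mat A n)) (dims A ! n)"
  by (metis carrier_matI dim_unfold_mat(2))

lemma unfold_inject:
  assumes d: "dims A = dims B" and n: "n < length (dims A)" and eq: "unfold_mat A n = unfold_mat B n"
  shows "A = B"
proof (rule tensor_eqI[OF d])
  fix "is" assume "is \<in> index_set (dims A)"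
  thus "entry A is = entry B is" using unfold_entry[of "is" A n] unfold_entry[of "is" B n] d n eq by simp
qed

lemma unfold_tensor_scale:
  assumes n: "n < length (dims A)"
  shows "unfold_mat (tensor_scale c A) n = c \<cdot>\<^sub>m unfold_mat A n"
proof (rule eq_matI)
  have d: "dims (tensor_scale c A) = dims A" by (simp add: tensor_scale_def)
  fix j i assume "j < dim_row (c \<cdot>\<^sub>m unfold_mat A n)" "i < dim_col (c \<cdot>\<^sub>m unfold_mat A n)"
  hence j: "j < dim_row (unfold_mat A n)" and i: "i < dims A ! n" by auto
  obtain "is" where "is": "is \<in> index_set (dims A)" "is ! n = i" "row_index (dims A) n is = j"
    "unfold_mat A n $$ (j, i) = entry A is"
    using unfold_mat_index[OF n j i] .
  have "unfold_mat (tensor_scale c A) n $$ (j, i) = entry (tensor_scale c A) is"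
    using unfold_entry[of "is" "tensor_scale c A" n] "is" n d by simp
  thus "unfold_mat (tensor_scale c A) n $$ (j, i) = (c \<cdot>\<^sub>m unfold_mat A n) $$ (j, i)"
    using "is" i j by (simp add: tensor_scale_def)
qed (auto simp: tensor_scale_def)

lemma unfold_zero:
  assumes n: "n < length ds"
  shows "unfold_mat (tensor ds (\<lambda>_. 0 :: 'a :: zero)) n
      = 0\<^sub>m (\<Prod>k \<in> {..<length ds} - {n}. ds ! k) (ds ! n)"
proof (rule eq_matI)
  let ?Z = "tensor ds (\<lambda>_. 0 :: 'a)" and ?O = "0\<^sub>m (\<Prod>k \<in> {..<length ds} - {n}. ds ! k) (ds ! n) :: 'a mat"
  fix j i assume "j < dim_row ?O" "i < dim_col ?O"
  hence j: "j < dim_row (unfold_mat ?Z n)" and i: "i < dims ?Z ! n" by auto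
  obtain "is" where "is \<in> index_set (dims ?Z)" "unfold_mat ?Z n $$ (j, i) = entry ?Z is"
    using unfold_mat_index[of n ?Z j i] n j i by auto
  thus "unfold_mat ?Z n $$ (j, i) = ?O $$ (j, i)" using i j by simp
qed auto

text \<open>In matrix form the equation reads
  \<open>unfold_mat A n * X\<^sup>T = unfold_mat A n * Y\<^sup>T\<close>, and an injective matrix
  cancels on the left.\<close>

lemma mode_prod_cancel:
  fixes A :: "'a :: field tensor"
  assumes inj: "inj_mat (unfold_mat A n)" and n: "n < length (dims A)"
    and X: "X \<in> carrier_mat k (dims A ! n)" and Y: "Y \<in> carrier_mat k (dims A ! n)"
    and eq: "mode_prod A n X = mode_prod A n Y"
  shows "X = Y"
proof -
  have "unfold_mat A n * X\<^sup>T = unfold_mat A n * Y\<^sup>T"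
    using unfold_mode_prod[OF n, of X] unfold_mode_prod[OF n, of Y] X Y eq by simp
  hence "X\<^sup>T = Y\<^sup>T"
    using inj_mat_mult_cancel[OF inj unfold_carrier, of "X\<^sup>T" k "Y\<^sup>T"] X Y by simp
  thus ?thesis by simp
qed

text \<open>A kernel vector of the unfolding, written as a single row \<open>X\<close>, is a mode
  product with value zero. Kernels can thus be studied with tensor algebra alone.\<close>

lemma inj_unfoldI:
  fixes A :: "'a :: field tensor"
  assumes n: "n < length (dims A)"
    and cancel: "\<And>X. X \<in> carrier_mat 1 (dims A ! n)
      \<Longrightarrow> mode_prod A n X = tensor ((dims A)[n := 1]) (\<lambda>_. 0) \<Longrightarrow> X = 0\<^sub>m 1 (dims A ! n)"
  shows "inj_mat (unfold_mat A n)"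
proof (rule inj_matI[OF unfold_carrier])
  let ?U = "unfold_mat A n"
  fix v assume v: "v \<in> carrier_vec (dims A ! n)" and z: "?U *\<^sub>v v = 0\<^sub>v (dim_row ?U)"
  define X where "X = mat_of_rows (dims A ! n) [v]"
  have X: "X \<in> carrier_mat 1 (dims A ! n)" by (simp add: X_def mat_of_rows_def)
  have cXT: "col (X\<^sup>T) 0 = v" using v by (intro eq_vecI) (auto simp: X_def mat_of_rows_def)
  have UX: "?U * X\<^sup>T = 0\<^sub>m (dim_row ?U) 1"
  proof (rule eq_matI)
    fix j i assume "j < dim_row (0\<^sub>m (dim_row ?U) 1 :: 'a mat)" "i < dim_col (0\<^sub>m (dim_row ?U) 1 :: 'a mat)"
    hence j: "j < dim_row ?U" and i: "i = 0" by auto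
    have "row ?U j \<bullet> v = (?U *\<^sub>v v) $ j" using j by simp
    thus "(?U * X\<^sup>T) $$ (j, i) = (0\<^sub>m (dim_row ?U) 1 :: 'a mat) $$ (j, i)"
      using z j i X cXT by simp
  qed (use X in auto)
  let ?Z = "tensor ((dims A)[n := 1]) (\<lambda>_. 0 :: 'a)"
  have rows: "(\<Prod>k \<in> {..<length (dims A)} - {n}. (dims A)[n := 1] ! k)
      = (\<Prod>k \<in> {..<length (dims A)} - {n}. dims A ! k)"
    by (intro prod.cong) auto
  have "unfold_mat (mode_prod A n X) n = unfold_mat ?Z n"
    using UX unfold_mode_prod[OF n, of X] X n rows by (simp add: unfold_zero)
  hence "mode_prod A n X = ?Z" using X n by (intro unfold_inject[of _ _ n]) auto
  hence "X = 0\<^sub>m 1 (dims A ! n)" by (rule cancel[OF X])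
  hence "X\<^sup>T = 0\<^sub>m (dims A ! n) 1" by simp
  hence "v = col (0\<^sub>m (dims A ! n) 1) 0" using cXT by simp
  thus "v = 0\<^sub>v (dims A ! n)" by simp
qed

section \<open>Multilinear products\<close>

lemma multi_prod_0 [simp]: "multi_prod 0 D X = D"
  by (simp add: multi_prod_def)

lemma multi_prod_Suc [simp]: "multi_prod (Suc N) D X = mode_prod (multi_prod N D X) N (X N)"
  by (simp add: multi_prod_def)

lemma multi_prod_cong:
  "(\<And>n. n < N \<Longrightarrow> X n = Y n) \<Longrightarrow> multi_prod N D X = multi_prod N D Y"
  by (induction N) auto

lemma dims_multi_prod:
  "dims (multi_prod N D X) = map (\<lambda>n. if n < N then dim_row (X n) else dims D ! n) [0..<length (dims D)]"
proof (induction N)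
  case 0
  show ?case by (simp add: map_nth)
next
  case (Suc N)
  show ?case
  proof (rule nth_equalityI)
    fix i assume "i < length (dims (multi_prod (Suc N) D X))"
    thus "dims (multi_prod (Suc N) D X) ! i =
        map (\<lambda>n. if n < Suc N then dim_row (X n) else dims D ! n) [0..<length (dims D)] ! i"
      by (cases "i = N") (auto simp: Suc)
  qed (simp add: Suc)
qed

text \<open>The extra factor commutes past all later modes until it meets the factor of its own
  mode, with which it merges.\<close>

lemma mode_prod_multi_prod:
  fixes D :: "'a :: comm_semiring_0 tensor"
  assumes "m < N" "N \<le> length (dims D)" "\<And>n. n < N \<Longrightarrow> dim_col (X n) = dims D ! n"
    and Z: "dim_col Z = dim_row (X m)"
  shows "mode_prod (multi_prod N D X) m Z = multi_prod N D (X(m := Z * X m))"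
  using assms(1-3)
proof (induction N)
  case (Suc N)
  show ?case
  proof (cases "m = N")
    case True
    have eq: "multi_prod N D (X(m := Z * X m)) = multi_prod N D X"
      using True by (intro multi_prod_cong) auto
    show ?thesis unfolding multi_prod_Suc eq
      using True Suc.prems Z by (simp add: mode_prod_mult dims_multi_prod)
  next
    case False
    have "mode_prod (mode_prod (multi_prod N D X) N (X N)) m Z
        = mode_prod (mode_prod (multi_prod N D X) m Z) N (X N)"
      using False Suc.prems Z by (intro mode_prod_commute) (auto simp: dims_multi_prod)
    thus ?thesis using Suc False by simp
  qed
qed simp

lemma multi_prod_mult:
  fixes A :: "'a :: comm_semiring_0 tensor"
  assumes N: "N \<le> length (dims A)" and Y: "\<And>n. n < N \<Longrightarrow> dim_col (Y n) = dims A ! n"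
    and X: "\<And>n. n < N \<Longrightarrow> dim_col (X n) = dim_row (Y n)"
  shows "multi_prod N (multi_prod N A Y) X = multi_prod N A (\<lambda>n. X n * Y n)"
proof -
  \<comment> \<open>The induction runs over the number \<open>k\<close> of outer factors already
    absorbed; the inner product keeps all \<open>N\<close> factors throughout.\<close>
  have "multi_prod k (multi_prod N A Y) X = multi_prod N A (\<lambda>n. if n < k then X n * Y n else Y n)"
    if "k \<le> N" for k
    using that
  proof (induction k)
    case (Suc k)
    have "multi_prod (Suc k) (multi_prod N A Y) X
        = mode_prod (multi_prod N A (\<lambda>n. if n < k then X n * Y n else Y n)) k (X k)"
      using Suc by simp
    also have "\<dots> = multi_prod N A ((\<lambda>n. if n < k then X n * Y n else Y n)(k := X k * Y k))"
      using Suc.prems N Y X by (subst mode_prod_multi_prod) auto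
    also have "\<dots> = multi_prod N A (\<lambda>n. if n < Suc k then X n * Y n else Y n)"
      by (intro multi_prod_cong) (auto simp: less_Suc_eq)
    finally show ?case .
  qed simp
  from this[of N] show ?thesis by (auto intro: trans multi_prod_cong)
qed

text \<open>Since products in different modes commute, any factor can be moved to the end;
  \<open>W\<close> is the product with the identity in place of that factor.\<close>

lemma multi_prod_factor:
  fixes D :: "'a :: comm_semiring_1 tensor"
  assumes m: "m < N" and N: "N \<le> length (dims D)" and X: "\<And>n. n < N \<Longrightarrow> dim_col (X n) = dims D ! n"
  obtains W where "dims W = (dims (multi_prod N D X))[m := dims D ! m]"
    and "multi_prod N D X = mode_prod W m (X m)"
proof
  let ?W = "multi_prod N D (X(m := 1\<^sub>m (dims D ! m)))"
  show "dims ?W = (dims (multi_prod N D X))[m := dims D ! m]"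
    using m N by (intro nth_equalityI) (auto simp: dims_multi_prod nth_list_update)
  have "mode_prod ?W m (X m) = multi_prod N D ((X(m := 1\<^sub>m (dims D ! m)))(m := X m * 1\<^sub>m (dims D ! m)))"
    using m N X by (subst mode_prod_multi_prod) auto
  also have "\<dots> = multi_prod N D X"
  proof (rule multi_prod_cong)
    have "X m * 1\<^sub>m (dims D ! m) = X m"
      by (rule right_mult_one_mat[of _ "dim_row (X m)"]) (rule carrier_matI[OF refl X[OF m]])
    thus "(X(m := 1\<^sub>m (dims D ! m), m := X m * 1\<^sub>m (dims D ! m))) n = X n" for n by simp
  qed
  finally show "multi_prod N D X = mode_prod ?W m (X m)" by simp
qed

section \<open>Column blocks\<close>

lemma nth_concat_blocks:
  assumes "\<And>r. r < R \<Longrightarrow> length (f r) = L r" and "r < R" and "k < L r"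
  shows "concat (map f [0..<R]) ! ((\<Sum>s<r. L s) + k) = f r ! k"
  using assms
proof (induction R)
  case (Suc R)
  have len: "length (concat (map f [0..<R])) = (\<Sum>s<R. L s)"
    using Suc.prems(1) by (simp add: length_concat comp_def interv_sum_list_conv_sum_set_nat atLeast0LessThan)
  show ?case
  proof (cases "r = R")
    case True
    thus ?thesis using Suc.prems len by (simp add: nth_append)
  next
    case False
    hence r: "r < R" using Suc.prems(2) by simp
    have "(\<Sum>s<r. L s) + k < (\<Sum>s<Suc r. L s)" using Suc.prems(3) by simp
    also have "\<dots> \<le> (\<Sum>s<R. L s)" using r by (intro sum_mono2) auto
    finally show ?thesis using Suc r len by (simp add: nth_append)
  qed
qed simp

lemma sum_blocks:
  fixes g :: "nat \<Rightarrow> 'a :: comm_monoid_add" and L :: "nat \<Rightarrow> nat" and R :: nat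
  shows "(\<Sum>l < (\<Sum>s<R. L s). g l) = (\<Sum>r<R. \<Sum>k<L r. g ((\<Sum>s<r. L s) + k))"
proof (induction R)
  case (Suc R)
  have "(\<Sum>l < m + k. g l) = (\<Sum>l<m. g l) + (\<Sum>l<k. g (m + l))" for m k
    by (induction k) (auto simp: add.assoc)
  thus ?case using Suc by simp
qed simp

lemma block_offset_less:
  fixes L :: "nat \<Rightarrow> nat"
  assumes "r < R" "k < L r"
  shows "(\<Sum>s<r. L s) + k < (\<Sum>s<R. L s)"
proof -
  have "(\<Sum>s<r. L s) + k < (\<Sum>s<Suc r. L s)" using assms by simp
  also have "\<dots> \<le> (\<Sum>s<R. L s)" using assms by (intro sum_mono2) auto
  finally show ?thesis .
qed

text \<open>Different blocks occupy disjoint ranges, because a position in an earlier block lies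
  below the offset of a later one.\<close>

lemma block_offset_eq_iff:
  fixes L :: "nat \<Rightarrow> nat"
  assumes "k < L r" "l < L s"
  shows "(\<Sum>i<r. L i) + k = (\<Sum>i<s. L i) + l \<longleftrightarrow> r = s \<and> k = l"
  using assms block_offset_less[of r s k L] block_offset_less[of s r l L]
  by (cases r s rule: linorder_cases) auto

lemma dim_hcat:
  assumes "\<And>r. r < R \<Longrightarrow> X r \<in> carrier_mat m (L r)"
  shows "hcat m (map X [0..<R]) \<in> carrier_mat m (\<Sum>r<R. L r)"
proof -
  have "length (concat (map cols (map X [0..<R]))) = (\<Sum>r<R. L r)"
    using carrier_matD(2)[OF assms] by (induction R) simp_all
  thus ?thesis unfolding hcat_def using mat_of_cols_carrier(1)[of m "concat (map cols (map X [0..<R]))"] by simp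
qed

lemma hcat_index:
  assumes X: "\<And>r. r < R \<Longrightarrow> X r \<in> carrier_mat m (L r)" and "r < R" "k < L r" "i < m"
  shows "hcat m (map X [0..<R]) $$ (i, (\<Sum>s<r. L s) + k) = X r $$ (i, k)"
proof -
  have len: "length (concat (map cols (map X [0..<R]))) = (\<Sum>r<R. L r)"
    using carrier_matD(2)[OF dim_hcat[of R X m L, OF X]] by (simp only: hcat_def mat_of_cols_carrier(3))
  have "hcat m (map X [0..<R]) $$ (i, (\<Sum>s<r. L s) + k)
      = concat (map cols (map X [0..<R])) ! ((\<Sum>s<r. L s) + k) $ i"
    unfolding hcat_def using assms(4) block_offset_less[of r R k L, OF assms(2,3)] len
    by (intro mat_of_cols_index) (simp_all only:)
  also have "\<dots> = cols (X r) ! k $ i"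
    unfolding map_map comp_def
    by (subst nth_concat_blocks[where L = L]) (use carrier_matD(2)[OF X] assms(2,3) in auto)
  also have "\<dots> = X r $$ (i, k)" using carrier_matD[OF X[OF \<open>r < R\<close>]] assms(3,4) by simp
  finally show ?thesis .
qed

text \<open>Rewrites the block diagonal matrix as an ordinary diagonal one, whose symmetry and
  single entries can then be read off.\<close>

lemma diag_block_scalar_mats:
  "diag_block_mat (map (\<lambda>r. c r \<cdot>\<^sub>m 1\<^sub>m (L r)) rs)
    = (let ds = concat (map (\<lambda>r. replicate (L r) (c r)) rs)
       in mat (length ds) (length ds) (\<lambda>(i, j). if i = j then ds ! i else 0 :: 'a :: semiring_1))"
proof (induction rs)
  case (Cons r rs)
  define ds where "ds = concat (map (\<lambda>r. replicate (L r) (c r)) rs)"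
  let ?k = "length ds"
  let ?A = "c r \<cdot>\<^sub>m 1\<^sub>m (L r)" and ?B = "mat ?k ?k (\<lambda>(i, j). if i = j then ds ! i else 0)"
  have "diag_block_mat (map (\<lambda>r. c r \<cdot>\<^sub>m 1\<^sub>m (L r)) (r # rs))
      = four_block_mat ?A (0\<^sub>m (L r) ?k) (0\<^sub>m ?k (L r)) ?B"
    using Cons unfolding ds_def by (simp add: Let_def)
  also have "\<dots> = mat (L r + ?k) (L r + ?k)
      (\<lambda>(i, j). if i = j then (replicate (L r) (c r) @ ds) ! i else 0)"
  proof (rule eq_matI)
    fix i j
    let ?M = "mat (L r + ?k) (L r + ?k) (\<lambda>(i, j). if i = j then (replicate (L r) (c r) @ ds) ! i else 0)"
    assume "i < dim_row ?M" "j < dim_col ?M"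
    hence ij: "i < L r + ?k" "j < L r + ?k" by auto
    have "four_block_mat ?A (0\<^sub>m (L r) ?k) (0\<^sub>m ?k (L r)) ?B $$ (i, j)
        = (if i < L r then if j < L r then ?A $$ (i, j) else 0
           else if j < L r then 0 else ?B $$ (i - L r, j - L r))"
      using ij by simp
    also have "\<dots> = ?M $$ (i, j)"
      using ij by (cases "i < L r"; cases "j < L r") (auto simp: nth_append)
    finally show "four_block_mat ?A (0\<^sub>m (L r) ?k) (0\<^sub>m ?k (L r)) ?B $$ (i, j) = ?M $$ (i, j)" .
  qed auto
  finally show ?case unfolding ds_def by (simp add: Let_def)
qed (auto simp: Let_def)

text \<open>The \<open>Y r\<close> are the blocks of rows of the inverse of the concatenation.\<close>

lemma hcat_dual_blocks:
  fixes X :: "nat \<Rightarrow> 'a :: field mat"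
  assumes X: "\<And>r. r < R \<Longrightarrow> X r \<in> carrier_mat m (L r)"
    and inv: "invertible_mat (hcat m (map X [0..<R]))"
  obtains Y where "\<And>r. r < R \<Longrightarrow> Y r \<in> carrier_mat (L r) m"
    and "\<And>r. r < R \<Longrightarrow> Y r * X r = 1\<^sub>m (L r)"
    and "\<And>r s. r < R \<Longrightarrow> s < R \<Longrightarrow> r \<noteq> s \<Longrightarrow> Y r * X s = 0\<^sub>m (L r) (L s)"
    and "\<And>i j. i < m \<Longrightarrow> j < m \<Longrightarrow> 1\<^sub>m m $$ (i, j) = (\<Sum>r<R. (X r * Y r) $$ (i, j))"
    and "\<And>M lam r. r < R \<Longrightarrow> M \<in> carrier_mat m m
      \<Longrightarrow> M = the (mat_inverse (hcat m (map X [0..<R]))\<^sup>T)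
            * diag_block_mat (map (\<lambda>r. lam r \<cdot>\<^sub>m 1\<^sub>m (L r)) [0..<R]) * (hcat m (map X [0..<R]))\<^sup>T
      \<Longrightarrow> Y r * M\<^sup>T = lam r \<cdot>\<^sub>m Y r"
proof -
  define H where "H = hcat m (map X [0..<R])"
  define off where "off r = (\<Sum>s<r. L s)" for r
  have HR: "H \<in> carrier_mat m (\<Sum>r<R. L r)" unfolding H_def by (rule dim_hcat[of R X m L, OF X])
  have invH: "square_mat H" "\<exists>G. inverts_mat H G \<and> inverts_mat G H"
    using inv unfolding H_def[symmetric] invertible_mat_def by auto
  have sum: "(\<Sum>r<R. L r) = m" using invH(1) carrier_matD[OF HR] by simp
  have H: "H \<in> carrier_mat m m" using HR unfolding sum .
  obtain G where G': "inverts_mat H G" "inverts_mat G H" using invH(2) by blast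
  have HG: "H * G = 1\<^sub>m m" using G'(1) carrier_matD[OF H] by (simp add: inverts_mat_def)
  have GH': "G * H = 1\<^sub>m (dim_row G)" using G'(2) by (simp add: inverts_mat_def)
  \<comment> \<open>\<open>inverts_mat\<close> does not prescribe the size of the inverse; both
    dimensions of \<open>G\<close> are read off from the two products.\<close>
  have "dim_col G = m" using arg_cong[OF HG, of dim_col] by simp
  moreover have "dim_row G = m" using arg_cong[OF GH', of dim_col] carrier_matD[OF H] by simp
  ultimately have G: "G \<in> carrier_mat m m" and GH: "G * H = 1\<^sub>m m" using GH' by (auto intro: carrier_matI)
  have off: "off r + k < m" if "r < R" "k < L r" for r k
    using block_offset_less[of r R k L] that sum by (simp add: off_def)
  have Hi: "H $$ (i, off r + k) = X r $$ (i, k)" if "r < R" "k < L r" "i < m" for i r k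
    using hcat_index[of R X m L r k i, OF X that] by (simp add: H_def off_def)
  define Y where "Y r = mat (L r) m (\<lambda>(k, j). G $$ (off r + k, j))" for r
  have Y: "Y r \<in> carrier_mat (L r) m" for r by (simp add: Y_def)
  \<comment> \<open>The products of dual and original blocks are the blocks of \<open>G * H\<close>,
    which is the identity; this gives biorthogonality.\<close>
  have YX: "(Y r * X s) $$ (k, l) = 1\<^sub>m m $$ (off r + k, off s + l)"
    if "r < R" "s < R" "k < L r" "l < L s" for r s k l
  proof -
    have "(Y r * X s) $$ (k, l) = (\<Sum>j<m. Y r $$ (k, j) * X s $$ (j, l))"
      using that X[OF \<open>s < R\<close>] Y[of r] by (simp add: scalar_prod_def atLeast0LessThan)
    also have "\<dots> = (\<Sum>j<m. G $$ (off r + k, j) * H $$ (j, off s + l))"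
      using that Hi by (intro sum.cong) (auto simp: Y_def)
    also have "\<dots> = (G * H) $$ (off r + k, off s + l)"
      using that off G H by (simp add: scalar_prod_def atLeast0LessThan)
    finally show ?thesis using GH by simp
  qed
  show thesis
  proof
    show "Y r \<in> carrier_mat (L r) m" for r by (rule Y)
    show "Y r * X r = 1\<^sub>m (L r)" if "r < R" for r
      using that X[OF that] Y[of r] YX[OF that that] off[OF that] by (intro eq_matI) auto
    show "Y r * X s = 0\<^sub>m (L r) (L s)" if rs: "r < R" "s < R" "r \<noteq> s" for r s
    proof (rule eq_matI)
      fix k l assume "k < dim_row (0\<^sub>m (L r) (L s) :: 'a mat)" "l < dim_col (0\<^sub>m (L r) (L s) :: 'a mat)"
      hence kl: "k < L r" "l < L s" by auto
      hence "off r + k \<noteq> off s + l"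
        using block_offset_eq_iff[of k L r l s, OF kl] rs(3) by (simp add: off_def)
      thus "(Y r * X s) $$ (k, l) = 0\<^sub>m (L r) (L s) $$ (k, l)"
        using YX[OF rs(1,2) kl] off[of r k] off[of s l] rs kl by simp
    qed (use X[OF rs(2)] Y[of r] in auto)
    show "1\<^sub>m m $$ (i, j) = (\<Sum>r<R. (X r * Y r) $$ (i, j))" if ij: "i < m" "j < m" for i j
    proof -
      have "1\<^sub>m m $$ (i, j) = (\<Sum>l<m. H $$ (i, l) * G $$ (l, j))"
        unfolding HG[symmetric] using H G ij by (simp add: scalar_prod_def atLeast0LessThan)
      also have "\<dots> = (\<Sum>r<R. \<Sum>k<L r. H $$ (i, off r + k) * G $$ (off r + k, j))"
        using sum_blocks[of "\<lambda>l. H $$ (i, l) * G $$ (l, j)" L R] unfolding sum off_def .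
      also have "\<dots> = (\<Sum>r<R. (X r * Y r) $$ (i, j))"
      proof (rule sum.cong)
        fix r assume "r \<in> {..<R}"
        hence r: "r < R" by simp
        show "(\<Sum>k<L r. H $$ (i, off r + k) * G $$ (off r + k, j)) = (X r * Y r) $$ (i, j)"
          using X[OF r] Y[of r] ij Hi[OF r _ ij(1)]
          by (simp add: scalar_prod_def atLeast0LessThan Y_def)
      qed simp
      finally show ?thesis .
    qed
    fix M and lam :: "nat \<Rightarrow> 'a" and r
    let ?D = "diag_block_mat (map (\<lambda>r. lam r \<cdot>\<^sub>m 1\<^sub>m (L r)) [0..<R])"
    assume r: "r < R" and M: "M \<in> carrier_mat m m"
      and eq: "M = the (mat_inverse (hcat m (map X [0..<R]))\<^sup>T) * ?D * (hcat m (map X [0..<R]))\<^sup>T"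
    define ds where "ds = concat (map (\<lambda>r. replicate (L r) (lam r)) [0..<R])"
    have len: "length ds = m"
      unfolding ds_def sum[symmetric]
      by (simp add: length_concat comp_def interv_sum_list_conv_sum_set_nat atLeast0LessThan)
    have D: "?D = mat m m (\<lambda>(i, j). if i = j then ds ! i else 0)"
      unfolding diag_block_scalar_mats Let_def ds_def[symmetric] len ..
    have dsn: "ds ! (off r + k) = lam r" if "k < L r" for k
      unfolding ds_def off_def using that r by (subst nth_concat_blocks[where L = L]) auto
    have HT: "H\<^sup>T \<in> carrier_mat m m" using H by simp
    have GHT: "H\<^sup>T * G\<^sup>T = 1\<^sub>m m" "G\<^sup>T * H\<^sup>T = 1\<^sub>m m"
      using GH HG G H by (metis transpose_mult transpose_one)+
    \<comment> \<open>\<open>the\<close> yields an inverse only if the option value is not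
      \<open>None\<close>, which invertibility guarantees.\<close>
    have "mat_inverse H\<^sup>T \<noteq> None"
    proof
      assume "mat_inverse H\<^sup>T = None"
      hence "H\<^sup>T \<notin> Units (ring_mat TYPE('a) m ())" by (rule mat_inverse(1)[OF HT])
      moreover have "H\<^sup>T \<in> Units (ring_mat TYPE('a) m ())"
        unfolding Units_def ring_mat_def using HT G GHT by auto
      ultimately show False by simp
    qed
    then obtain K where K: "mat_inverse H\<^sup>T = Some K" by blast
    note K' = mat_inverse(2)[OF HT K]
    have Dc: "?D \<in> carrier_mat m m" unfolding D by simp
    have "H\<^sup>T * M = H\<^sup>T * (K * ?D * H\<^sup>T)"
      using eq K unfolding H_def[symmetric] by simp
    also have "\<dots> = H\<^sup>T * (K * (?D * H\<^sup>T))"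
      using K' Dc HT by (subst assoc_mult_mat[of K m m ?D m "H\<^sup>T" m]) auto
    also have "\<dots> = H\<^sup>T * K * (?D * H\<^sup>T)"
      using K' Dc HT by (intro assoc_mult_mat[symmetric]) auto
    also have "\<dots> = ?D * H\<^sup>T" using K' Dc HT by simp
    finally have HM: "H\<^sup>T * M = ?D * H\<^sup>T" .
    have "(H\<^sup>T * M)\<^sup>T = M\<^sup>T * H" using H M by (simp add: transpose_mult)
    moreover have "(?D * H\<^sup>T)\<^sup>T = H * ?D\<^sup>T" using H Dc by (simp add: transpose_mult)
    moreover have "?D\<^sup>T = ?D" unfolding D by (rule eq_matI) auto
    \<comment> \<open>Multiplying this by \<open>G\<close> from both sides gives
      \<open>G * M\<^sup>T = ?D * G\<close>, whose \<open>r\<close>th block of rows is the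
      claim.\<close>
    ultimately have MH: "M\<^sup>T * H = H * ?D" using HM by simp
    have "G * M\<^sup>T = G * M\<^sup>T * (H * G)" using HG G M by simp
    also have "\<dots> = G * (M\<^sup>T * H) * G"
      using G M H by (simp add: assoc_mult_mat[of _ m m _ m _ m])
    also have "\<dots> = (G * H) * ?D * G" unfolding MH
      using G H Dc by (simp add: assoc_mult_mat[of _ m m _ m _ m])
    also have "\<dots> = ?D * G" unfolding GH using Dc by simp
    finally have GM: "G * M\<^sup>T = ?D * G" .
    show "Y r * M\<^sup>T = lam r \<cdot>\<^sub>m Y r"
    proof (rule eq_matI)
      fix k j assume "k < dim_row (lam r \<cdot>\<^sub>m Y r)" "j < dim_col (lam r \<cdot>\<^sub>m Y r)"
      hence k: "k < L r" and j: "j < m" using Y[of r] by auto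
      note o = off[OF r k]
      have "(Y r * M\<^sup>T) $$ (k, j) = (\<Sum>l<m. Y r $$ (k, l) * M $$ (j, l))"
        using Y[of r] M k j by (simp add: scalar_prod_def atLeast0LessThan)
      also have "\<dots> = (\<Sum>l<m. G $$ (off r + k, l) * M $$ (j, l))"
        using k by (simp add: Y_def)
      also have "\<dots> = (G * M\<^sup>T) $$ (off r + k, j)"
        using o G M j by (simp add: scalar_prod_def atLeast0LessThan)
      also have "\<dots> = (\<Sum>l<m. ?D $$ (off r + k, l) * G $$ (l, j))"
        unfolding GM using o G Dc j by (simp add: scalar_prod_def atLeast0LessThan)
      also have "\<dots> = (\<Sum>l<m. if l = off r + k then lam r * G $$ (l, j) else 0)"
        unfolding D using o dsn[OF k] by (intro sum.cong) auto
      also have "\<dots> = lam r * G $$ (off r + k, j)" using o by simp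
      finally show "(Y r * M\<^sup>T) $$ (k, j) = (lam r \<cdot>\<^sub>m Y r) $$ (k, j)"
        using k j by (simp add: Y_def)
    qed (use Y[of r] M in auto)
  qed
qed

section \<open>Tensors with coupled matrix representations\<close>

text \<open>A row \<open>V\<close> that annihilates \<open>A\<close> in mode \<open>n\<close>
  annihilates each term, because the term arises from \<open>A\<close> by a product in another mode.
  The rank condition on the term then yields \<open>V * X n r = 0\<close> for every
  \<open>r\<close>, and the blocks \<open>X n r\<close> together span the space.\<close>

lemma inj_unfold_of_decomposition:
  fixes A :: "'a :: field tensor"
  assumes Nh: "2 \<le> Nh" "Nh \<le> length (dims A)"
    and D: "\<And>r. r < R \<Longrightarrow> dims (D r) = core_dims Nh (dims A) L r"
    and X: "\<And>n r. n < Nh \<Longrightarrow> r < R \<Longrightarrow> X n r \<in> carrier_mat (dims A ! n) (L n r)"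
    and decomp: "ml_decomposition Nh R L (\<lambda>r. multi_prod Nh (D r) (\<lambda>n. X n r)) A"
    and inv: "\<And>n. n < Nh \<Longrightarrow> invertible_mat (hcat (dims A ! n) (map (X n) [0..<R]))"
    and n: "n < Nh"
  shows "inj_mat (unfold_mat A n)"
proof -
  define T where "T r = multi_prod Nh (D r) (\<lambda>n. X n r)" for r
  have dT: "dims (T r) = dims A" and rT: "mat_rank (unfold_mat (T r) n) = L n r" if "r < R" for r
    using decomp that n by (auto simp: ml_decomposition_def T_def ml_rank_def)
  have AT: "A = tensor_sum (dims A) R T"
    using decomp unfolding ml_decomposition_def T_def by blast
  \<comment> \<open>A second mode exists because \<open>2 \<le> Nh\<close>.\<close>
  have "\<exists>m. m < Nh \<and> m \<noteq> n"
    using Nh by (intro exI[of _ "if n = 0 then 1 else 0"]) auto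
  then obtain m where m: "m < Nh" "m \<noteq> n" by blast
  have nl: "n < length (dims A)" and ml: "m < length (dims A)" using m n Nh by auto
  obtain Y where Y: "\<And>r. r < R \<Longrightarrow> Y r \<in> carrier_mat (L m r) (dims A ! m)"
    and Y1: "\<And>r. r < R \<Longrightarrow> Y r * X m r = 1\<^sub>m (L m r)"
    and Y0: "\<And>r s. r < R \<Longrightarrow> s < R \<Longrightarrow> r \<noteq> s \<Longrightarrow> Y r * X m s = 0\<^sub>m (L m r) (L m s)"
    by (rule hcat_dual_blocks[of R "X m" "dims A ! m" "L m", OF X[OF m(1)] inv[OF m(1)]], assumption, rule that)
  obtain Y' where Y': "\<And>r. r < R \<Longrightarrow> Y' r \<in> carrier_mat (L n r) (dims A ! n)"
    and Y's: "\<And>i j. i < dims A ! n \<Longrightarrow> j < dims A ! n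
      \<Longrightarrow> 1\<^sub>m (dims A ! n) $$ (i, j) = (\<Sum>r<R. (X n r * Y' r) $$ (i, j))"
    by (rule hcat_dual_blocks[of R "X n" "dims A ! n" "L n", OF X[OF n] inv[OF n]], assumption, rule that)
  have W: "\<exists>W. dims W = (dims A)[k := L k r] \<and> T r = mode_prod W k (X k r)"
    if r: "r < R" and k: "k < Nh" for r k
  proof -
    have dk: "dims (D r) ! i = L i r" if "i < Nh" for i
      using D[OF r] Nh that by (simp add: core_dims_def)
    have len: "length (dims (D r)) = length (dims A)" using D[OF r] by (simp add: core_dims_def)
    obtain W where 1: "dims W = (dims (T r))[k := dims (D r) ! k]" and 2: "T r = mode_prod W k (X k r)"
      using multi_prod_factor[of k Nh "D r" "\<lambda>n. X n r"] k Nh(2) len dk carrier_matD(2)[OF X[OF _ r]]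
      unfolding T_def by metis
    show ?thesis using 1 2 unfolding dT[OF r] dk[OF k] by blast
  qed
  show ?thesis
  proof (rule inj_unfoldI[OF nl])
    fix V :: "'a mat" assume V: "V \<in> carrier_mat 1 (dims A ! n)"
      and z: "mode_prod A n V = tensor ((dims A)[n := 1]) (\<lambda>_. 0)"
    have VX: "V * X n r = 0\<^sub>m 1 (L n r)" if r: "r < R" for r
    proof -
      \<comment> \<open>The projection onto the \<open>r\<close>th column block in mode
        \<open>m\<close> along the other blocks.\<close>
      let ?Q = "X m r * Y r"
      note Xr = X[OF m(1) r] and Yr = Y[OF r]
      have Q: "?Q \<in> carrier_mat (dims A ! m) (dims A ! m)" using Xr Yr by simp
      have TQ: "entry (mode_prod (T s) m ?Q) is = (if s = r then entry (T r) is else 0)"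
        if s: "s < R" and "is": "is \<in> index_set (dims A)" for s "is"
      proof -
        obtain W where dW: "dims W = (dims A)[m := L m s]" and TW: "T s = mode_prod W m (X m s)"
          using W[OF s m(1)] by blast
        have "mode_prod (T s) m ?Q = mode_prod W m (?Q * X m s)"
          unfolding TW using dW ml carrier_matD[OF X[OF m(1) s]] carrier_matD[OF Q]
          by (intro mode_prod_mult) simp_all
        also have "?Q * X m s = X m r * (Y r * X m s)"
          by (rule assoc_mult_mat[OF Xr Yr X[OF m(1) s]])
        also have "\<dots> = (if s = r then X m r else 0\<^sub>m (dims A ! m) (L m s))"
          using Y1[OF r] Y0[OF r s] Xr by auto
        finally have eq: "mode_prod (T s) m ?Q = mode_prod W m (if s = r then X m r else 0\<^sub>m (dims A ! m) (L m s))" .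
        show ?thesis
        proof (cases "s = r")
          case True
          thus ?thesis using eq TW by simp
        next
          case False
          hence "mode_prod (T s) m ?Q = tensor (dims A) (\<lambda>_. 0)"
            using eq dW ml by (simp add: mode_prod_zero)
          thus ?thesis using False "is" by simp
        qed
      qed
      have AQ: "mode_prod A m ?Q = T r"
      proof (rule tensor_eqI)
        have d: "(dims A)[m := dim_row (X m r)] = dims A" using Xr by simp
        show "dims (mode_prod A m ?Q) = dims (T r)" using d dT[OF r] by simp
        fix "is" assume "is \<in> index_set (dims (mode_prod A m ?Q))"
        hence "is": "is \<in> index_set (dims A)" using d by simp
        have "entry (mode_prod A m ?Q) is = (\<Sum>s<R. entry (mode_prod (T s) m ?Q) is)"
          by (subst AT, rule entry_mode_prod_tensor_sum) (use dT "is" d carrier_matD[OF Q] in auto)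
        also have "\<dots> = (\<Sum>s<R. if s = r then entry (T r) is else 0)"
          using TQ "is" by (intro sum.cong) auto
        finally show "entry (mode_prod A m ?Q) is = entry (T r) is" using r by simp
      qed
      have "mode_prod (T r) n V = mode_prod (mode_prod A n V) m ?Q"
        unfolding AQ[symmetric] using m(2) carrier_matD[OF Q] carrier_matD[OF V]
        by (intro mode_prod_commute) auto
      also have "\<dots> = tensor ((dims A)[n := 1]) (\<lambda>_. 0)"
        unfolding z using m(2) carrier_matD[OF Q] list_update_id[of "(dims A)[n := 1]" m]
        by (simp add: mode_prod_of_zero del: One_nat_def index_mult_mat)
      finally have TV: "mode_prod (T r) n V = tensor ((dims A)[n := 1]) (\<lambda>_. 0)" .
      obtain W where dW: "dims W = (dims A)[n := L n r]" and TW: "T r = mode_prod W n (X n r)"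
        using W[OF r n] by blast
      note Xn = X[OF n r]
      have lW: "n < length (dims W)" and nW: "dims W ! n = L n r" using dW nl by auto
      have "unfold_mat (T r) n = unfold_mat W n * (X n r)\<^sup>T"
        unfolding TW using nW carrier_matD[OF Xn] by (intro unfold_mode_prod[OF lW]) simp
      \<comment> \<open>\<open>unfold_mat W n\<close> has only \<open>L n r\<close> columns, and the
        rank of the term forces its rank to be at least that large, so it is injective.\<close>
      moreover have "mat_rank (unfold_mat W n * (X n r)\<^sup>T) \<le> mat_rank (unfold_mat W n)"
        by (rule mat_rank_mono[OF unfold_carrier]) (use Xn nW in auto)
      ultimately have "L n r \<le> mat_rank (unfold_mat W n)" using rT[OF r] by simp
      hence injW: "inj_mat (unfold_mat W n)"
        using inj_mat_of_rank[OF unfold_carrier, of W n] nW by simp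
      have "mode_prod W n (V * X n r) = mode_prod (T r) n V"
        unfolding TW by (rule mode_prod_mult[symmetric])
          (use lW nW carrier_matD[OF Xn] carrier_matD[OF V] in auto)
      also have "\<dots> = mode_prod W n (0\<^sub>m 1 (L n r))"
        unfolding TV using dW by (simp add: mode_prod_zero[OF lW])
      finally show ?thesis
        by (rule mode_prod_cancel[OF injW lW, rotated 2]) (use V Xn nW in auto)
    qed
    show "V = 0\<^sub>m 1 (dims A ! n)"
    proof (rule eq_matI)
      fix i j assume "i < dim_row (0\<^sub>m 1 (dims A ! n) :: 'a mat)" "j < dim_col (0\<^sub>m 1 (dims A ! n) :: 'a mat)"
      hence i: "i < 1" and j: "j < dims A ! n" by auto
      \<comment> \<open>\<open>V\<close> is multiplied by the identity, which is resolved into the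
        products \<open>X n r * Y' r\<close>.\<close>
      have "V $$ (i, j) = (\<Sum>l<dims A ! n. if l = j then V $$ (i, l) else 0)" using j by simp
      also have "\<dots> = (\<Sum>l<dims A ! n. V $$ (i, l) * 1\<^sub>m (dims A ! n) $$ (l, j))"
        using j by (intro sum.cong) auto
      also have "\<dots> = (\<Sum>l<dims A ! n. \<Sum>r<R. V $$ (i, l) * (X n r * Y' r) $$ (l, j))"
        using Y's j by (intro sum.cong) (simp_all del: index_one_mat add: sum_distrib_left)
      also have "\<dots> = (\<Sum>r<R. \<Sum>l<dims A ! n. V $$ (i, l) * (X n r * Y' r) $$ (l, j))"
        by (rule sum.swap)
      also have "\<dots> = (\<Sum>r<R. (V * (X n r * Y' r)) $$ (i, j))"
      proof (rule sum.cong)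
        fix r assume "r \<in> {..<R}"
        hence "X n r * Y' r \<in> carrier_mat (dims A ! n) (dims A ! n)"
          using X[OF n, of r] Y'[of r] by simp
        from index_mult_mat_sum[OF V this i j]
        show "(\<Sum>l<dims A ! n. V $$ (i, l) * (X n r * Y' r) $$ (l, j)) = (V * (X n r * Y' r)) $$ (i, j)" ..
      qed simp
      also have "\<dots> = 0"
      proof (rule sum.neutral, rule ballI)
        fix r assume "r \<in> {..<R}"
        hence r: "r < R" by simp
        have "V * (X n r * Y' r) = V * X n r * Y' r"
          by (rule assoc_mult_mat[OF V X[OF n r] Y'[OF r], symmetric])
        also have "\<dots> = 0\<^sub>m 1 (dims A ! n)" unfolding VX[OF r] using Y'[OF r] by simp
        finally show "(V * (X n r * Y' r)) $$ (i, j) = 0" using i j by simp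
      qed
      finally show "V $$ (i, j) = 0\<^sub>m 1 (dims A ! n) $$ (i, j)" using i j by simp
    qed (use V in auto)
  qed
qed

section \<open>Spectra and diagonalizability of the coupled matrices\<close>

text \<open>Equal column spaces and injectivity of \<open>U\<close> put every unit vector into the
  range of \<open>M\<close>; a vector annihilated by the transpose of \<open>M\<close> is orthogonal
  to that range and hence zero.\<close>

lemma zero_notin_spectrum:
  fixes U M :: "'a :: field mat"
  assumes inj: "inj_mat U" and U: "U \<in> carrier_mat k n" and M: "M \<in> carrier_mat n n"
    and col: "mat_col_space U = mat_col_space (U * M)"
  shows "0 \<notin> spectrum M"
proof
  assume "0 \<in> spectrum M"
  hence "poly (char_poly M\<^sup>T) 0 = 0" using spectrum_root_char_poly[OF M] M by simp
  hence "eigenvalue M\<^sup>T 0" using eigenvalue_root_char_poly[of "M\<^sup>T" n 0] M by simp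
  then obtain u where u: "u \<in> carrier_vec n" "u \<noteq> 0\<^sub>v n" and "M\<^sup>T *\<^sub>v u = 0 \<cdot>\<^sub>v u"
    unfolding eigenvalue_def eigenvector_def using M by auto
  hence Mu: "M\<^sup>T *\<^sub>v u = 0\<^sub>v n" by (auto intro!: eq_vecI)
  have "u $ i = 0" if i: "i < n" for i
  proof -
    interpret vec_space "TYPE('a)" k .
    have UM: "U * M \<in> carrier_mat k n" using U M by simp
    have "U *\<^sub>v unit_vec n i \<in> mat_col_space U"
      unfolding mat_col_space_def carrier_matD(1)[OF U] col_space_eq[OF U] using U by auto
    hence "U *\<^sub>v unit_vec n i \<in> mat_col_space (U * M)" using col by simp
    then obtain v where v: "v \<in> carrier_vec n" "U * M *\<^sub>v v = U *\<^sub>v unit_vec n i"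
      unfolding mat_col_space_def carrier_matD(1)[OF UM] col_space_eq[OF UM] using M by auto
    have "U *\<^sub>v (M *\<^sub>v v) = U *\<^sub>v unit_vec n i" using v U M by simp
    hence Mv: "M *\<^sub>v v = unit_vec n i"
      using inj_mat_cancel[OF inj U, of "M *\<^sub>v v" "unit_vec n i"] M v(1) by simp
    have "u $ i = u \<bullet> (M *\<^sub>v v)" unfolding Mv using u(1) i by simp
    also have "\<dots> = (M\<^sup>T *\<^sub>v u) \<bullet> v"
      using transpose_vec_mult_scalar[of M n n v u] M v(1) u(1) by simp
    also have "\<dots> = 0" unfolding Mu using v(1) by simp
    finally show ?thesis .
  qed
  hence "u = 0\<^sub>v n" using u(1) by (intro eq_vecI) auto
  with u(2) show False by simp
qed

text \<open>The contraction \<open>T\<close> with an eigenvector of \<open>Mn\<close> keeps mode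
  \<open>m\<close>, where \<open>Mm\<close> acts on it as the scalar \<open>c\<close>. Equality of
  the spectra follows by exchanging the modes.\<close>

lemma spectrum_coupled:
  fixes A :: "'a :: field tensor"
  assumes mn: "m \<noteq> n" "m < length (dims A)" "n < length (dims A)"
    and Mm: "Mm \<in> carrier_mat (dims A ! m) (dims A ! m)"
    and Mn: "Mn \<in> carrier_mat (dims A ! n) (dims A ! n)"
    and eq: "mode_prod A m Mm\<^sup>T = mode_prod A n Mn\<^sup>T"
    and inj: "inj_mat (unfold_mat A n)"
  shows "spectrum Mn \<subseteq> spectrum Mm"
proof
  fix c assume "c \<in> spectrum Mn"
  then obtain v where v: "v \<in> carrier_vec (dims A ! n)" "v \<noteq> 0\<^sub>v (dims A ! n)" "Mn *\<^sub>v v = c \<cdot>\<^sub>v v"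
    unfolding spectrum_def eigenvalue_def eigenvector_def using Mn by auto
  \<comment> \<open>The eigenvector becomes a one-row matrix, so that contracting mode
    \<open>n\<close> with it is a mode product.\<close>
  define V where "V = mat 1 (dims A ! n) (\<lambda>(_, j). v $ j)"
  have V: "V \<in> carrier_mat 1 (dims A ! n)" by (simp add: V_def)
  have VM: "V * Mn\<^sup>T = c \<cdot>\<^sub>m V"
  proof (rule eq_matI)
    fix i j assume "i < dim_row (c \<cdot>\<^sub>m V)" "j < dim_col (c \<cdot>\<^sub>m V)"
    hence ij: "i = 0" "j < dims A ! n" using V by auto
    have "(V * Mn\<^sup>T) $$ (i, j) = (\<Sum>l<dims A ! n. v $ l * Mn $$ (j, l))"
      using ij Mn by (simp add: V_def scalar_prod_def atLeast0LessThan)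
    also have "\<dots> = (Mn *\<^sub>v v) $ j"
      using ij Mn v(1) by (simp add: scalar_prod_def atLeast0LessThan mult.commute)
    also have "\<dots> = (c \<cdot>\<^sub>m V) $$ (i, j)" unfolding v(3) using ij v(1) by (simp add: V_def)
    finally show "(V * Mn\<^sup>T) $$ (i, j) = (c \<cdot>\<^sub>m V) $$ (i, j)" .
  qed (use V Mn in auto)
  define T where "T = mode_prod A n V"
  have dT: "dims T = (dims A)[n := 1]" using V by (simp add: T_def)
  have "mode_prod T m Mm\<^sup>T = mode_prod (mode_prod A m Mm\<^sup>T) n V"
    unfolding T_def using mn Mm V by (intro mode_prod_commute) auto
  also have "\<dots> = mode_prod A n (V * Mn\<^sup>T)"
    unfolding eq using mn V Mn by (intro mode_prod_mult) auto
  also have "\<dots> = tensor_scale c T"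
    unfolding VM T_def by (rule mode_prod_smult[OF mn(3)])
  finally have "unfold_mat (mode_prod T m Mm\<^sup>T) m = c \<cdot>\<^sub>m unfold_mat T m"
    using mn dT by (simp add: unfold_tensor_scale)
  hence "unfold_mat T m * Mm = c \<cdot>\<^sub>m unfold_mat T m"
    using unfold_mode_prod[of m T "Mm\<^sup>T"] mn dT Mm by simp
  moreover have UT: "unfold_mat T m \<in> carrier_mat (dim_row (unfold_mat T m)) (dims A ! m)"
    using unfold_carrier[of T m] mn dT by simp
  \<comment> \<open>If \<open>T\<close> were zero, injectivity of the mode-\<open>n\<close>
    unfolding of \<open>A\<close> would make the eigenvector zero.\<close>
  moreover have "unfold_mat T m \<noteq> 0\<^sub>m (dim_row (unfold_mat T m)) (dims A ! m)"
  proof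
    assume "unfold_mat T m = 0\<^sub>m (dim_row (unfold_mat T m)) (dims A ! m)"
    hence "unfold_mat T m = unfold_mat (tensor ((dims A)[n := 1]) (\<lambda>_. 0)) m"
      using mn dT by (simp add: unfold_zero)
    hence "T = tensor ((dims A)[n := 1]) (\<lambda>_. 0)"
      using mn dT by (intro unfold_inject[of _ _ m]) auto
    hence "mode_prod A n V = mode_prod A n (0\<^sub>m 1 (dims A ! n))"
      using mn by (simp add: T_def mode_prod_zero)
    hence V0: "V = 0\<^sub>m 1 (dims A ! n)" using mode_prod_cancel[OF inj mn(3) V] by simp
    have "v $ j = 0" if j: "j < dims A ! n" for j
    proof -
      have "v $ j = V $$ (0, j)" using j by (simp add: V_def)
      also have "\<dots> = 0" unfolding V0 using j by simp
      finally show ?thesis .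
    qed
    hence "v = 0\<^sub>v (dims A ! n)" using v(1) by (intro eq_vecI) auto
    with v(2) show False by simp
  qed
  ultimately show "c \<in> spectrum Mm" by (intro eigenvalue_of_left_eigenvector[OF Mm UT])
qed

lemma row_index_update: "row_index ds n (is[n := l]) = row_index ds n is"
  unfolding row_index_def by (intro sum.cong) auto

text \<open>Equal row numbers leave freedom only in position \<open>n\<close>. Indices in other
  modes are therefore functions of the row, which \<open>diagonalizable_coupled\<close> needs to
  assign one eigenvalue to each row.\<close>

lemma row_index_eq_nth:
  assumes "is \<in> index_set ds" "js \<in> index_set ds" "row_index ds n is = row_index ds n js"
    and "m \<noteq> n" "n < length ds"
  shows "is ! m = js ! m"
proof -
  have "js[n := is ! n] \<in> index_set ds"
    using index_set_update[of js ds n "ds ! n" "is ! n"] assms index_set_nth by simp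
  moreover have "js[n := is ! n] ! n = is ! n"
    using assms index_set_length by simp
  ultimately have "is = js[n := is ! n]"
    using row_index_inj[OF assms(1), of "js[n := is ! n]" n] assms(3) by (simp add: row_index_update)
  thus ?thesis using assms(4) by (metis nth_list_update_neq)
qed

text \<open>
  If the mode-\<open>m\<close> product with \<open>P\<close> diagonalizes the action of \<open>Mm\<close>,
  the resulting mode-\<open>n\<close> fibers are left eigenvectors of \<open>Mn\<close>, and they span the space.
\<close>

lemma diagonalizable_coupled:
  fixes A :: "'a :: field tensor"
  assumes mn: "m \<noteq> n" "m < length (dims A)" "n < length (dims A)"
    and Mm: "Mm \<in> carrier_mat (dims A ! m) (dims A ! m)"
    and Mn: "Mn \<in> carrier_mat (dims A ! n) (dims A ! n)"
    and eq: "mode_prod A m Mm\<^sup>T = mode_prod A n Mn\<^sup>T"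
    and inj: "inj_mat (unfold_mat A n)"
    and diag: "diagonalizable_mat Mm"
  shows "diagonalizable_mat Mn"
proof -
  let ?m = "dims A ! m"
  obtain D where dD: "diagonal_mat D" and sim: "similar_mat Mm D"
    using diag unfolding diagonalizable_mat_def by blast
  obtain P Q where wit: "similar_mat_wit Mm D P Q" using sim unfolding similar_mat_def by blast
  note w = similar_mat_witD2[OF Mm wit]
  have D: "D \<in> carrier_mat ?m ?m" and P: "P \<in> carrier_mat ?m ?m" and Q: "Q \<in> carrier_mat ?m ?m" using w by auto
  have DT: "D\<^sup>T = D"
  proof (rule eq_matI)
    fix i j assume "i < dim_row D" "j < dim_col D"
    thus "D\<^sup>T $$ (i, j) = D $$ (i, j)"
      using dD D unfolding diagonal_mat_def by (cases "i = j") auto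
  qed (use D in auto)
  have QPT: "Q\<^sup>T * P\<^sup>T = 1\<^sub>m ?m"
    using transpose_mult[OF P Q] w(1) by simp
  have "Mm * P = P * D * (Q * P)"
    unfolding w(3) using P D Q by (intro assoc_mult_mat) auto
  also have "\<dots> = P * D" unfolding w(2) using P D by simp
  finally have "P\<^sup>T * Mm\<^sup>T = D * P\<^sup>T"
    using transpose_mult[OF Mm P] transpose_mult[OF P D] DT by simp
  note PM = this
  \<comment> \<open>The tensor in coordinates for mode \<open>m\<close> in which \<open>Mm\<close>
    acts diagonally.\<close>
  define U where "U = mode_prod A m P\<^sup>T"
  have dU: "dims U = dims A" using P by (simp add: U_def)
  have U_commute: "mode_prod U n V = mode_prod (mode_prod A n V) m P\<^sup>T" if "dim_col V = dims A ! n" for V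
    unfolding U_def using mn P that by (intro mode_prod_commute) auto
  have injU: "inj_mat (unfold_mat U n)"
  proof (rule inj_unfoldI)
    fix V assume "V \<in> carrier_mat 1 (dims U ! n)"
      and z: "mode_prod U n V = tensor ((dims U)[n := 1]) (\<lambda>_. 0)"
    hence V: "V \<in> carrier_mat 1 (dims A ! n)" using dU by simp
    \<comment> \<open>The product with \<open>Q\<^sup>T\<close> undoes that with
      \<open>P\<^sup>T\<close>, so a row annihilating \<open>U\<close> annihilates
      \<open>A\<close>.\<close>
    have "mode_prod A n V = mode_prod (mode_prod A n V) m (1\<^sub>m ?m)"
      using mode_prod_one[of m "mode_prod A n V"] mn V by simp
    also have "\<dots> = mode_prod (mode_prod (mode_prod A n V) m P\<^sup>T) m Q\<^sup>T"
      unfolding QPT[symmetric] using mn P Q V by (intro mode_prod_mult[symmetric]) auto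
    also have "\<dots> = mode_prod (tensor ((dims A)[n := 1]) (\<lambda>_. 0)) m Q\<^sup>T"
      using U_commute[of V] z V dU by simp
    also have "\<dots> = tensor ((dims A)[n := 1]) (\<lambda>_. 0)"
      using mn Q list_update_id[of "(dims A)[n := 1]" m] by (simp add: mode_prod_of_zero del: One_nat_def)
    also have "\<dots> = mode_prod A n (0\<^sub>m 1 (dims A ! n))" using mn by (simp add: mode_prod_zero)
    finally show "V = 0\<^sub>m 1 (dims U ! n)"
      unfolding dU by (rule mode_prod_cancel[OF inj mn(3) V, rotated]) simp
  qed (use mn dU in simp)
  have "mode_prod U n Mn\<^sup>T = mode_prod (mode_prod A m Mm\<^sup>T) m P\<^sup>T"
    using U_commute[of "Mn\<^sup>T"] Mn eq by simp
  also have "\<dots> = mode_prod A m (D * P\<^sup>T)"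
    unfolding PM[symmetric] using mn P Mm by (intro mode_prod_mult) auto
  also have "\<dots> = mode_prod U m D"
    unfolding U_def using mn P D by (intro mode_prod_mult[symmetric]) auto
  finally have UM: "mode_prod U n Mn\<^sup>T = mode_prod U m D" .
  have UMe: "entry (mode_prod U n Mn\<^sup>T) is = D $$ (is ! m, is ! m) * entry U is"
    if "is": "is \<in> index_set (dims A)" for "is"
  proof -
    have ism: "is ! m < ?m" using index_set_nth[OF "is" mn(2)] .
    have "entry (mode_prod U n Mn\<^sup>T) is = (\<Sum>l<?m. D $$ (is ! m, l) * entry U (is[m := l]))"
      unfolding UM using D dU "is" by (simp add: entry_mode_prod)
    also have "\<dots> = (\<Sum>l<?m. if l = is ! m then D $$ (is ! m, is ! m) * entry U is else 0)"
      using dD D ism unfolding diagonal_mat_def by (intro sum.cong) auto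
    finally show ?thesis using ism by simp
  qed
  \<comment> \<open>A row of the mode-\<open>n\<close> unfolding fixes the index in mode
    \<open>m\<close>, so every tuple with that row number selects the same eigenvalue.\<close>
  define d where "d j = (let is = (SOME is. is \<in> index_set (dims A) \<and> row_index (dims A) n is = j)
    in D $$ (is ! m, is ! m))" for j
  have d: "d (row_index (dims A) n is) = D $$ (is ! m, is ! m)" if "is": "is \<in> index_set (dims A)" for "is"
  proof -
    let ?js = "SOME js. js \<in> index_set (dims A) \<and> row_index (dims A) n js = row_index (dims A) n is"
    have "?js \<in> index_set (dims A) \<and> row_index (dims A) n ?js = row_index (dims A) n is"
      by (rule someI) (use "is" in simp)
    hence "?js ! m = is ! m" using row_index_eq_nth[of ?js "dims A" "is" n m] "is" mn by simp
    thus ?thesis by (simp add: d_def)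
  qed
  let ?U = "unfold_mat U n"
  have Uc: "?U \<in> carrier_mat (dim_row ?U) (dims A ! n)" using unfold_carrier[of U n] dU by simp
  show ?thesis
  proof (rule diagonalizable_of_left_eigenvectors[OF injU Uc Mn])
    fix j assume j: "j < dim_row ?U"
    show "Mn\<^sup>T *\<^sub>v row ?U j = d j \<cdot>\<^sub>v row ?U j"
    proof (rule eq_vecI)
      fix i assume "i < dim_vec (d j \<cdot>\<^sub>v row ?U j)"
      hence i: "i < dims A ! n" using dU by simp
      obtain "is" where "is": "is \<in> index_set (dims A)" "is ! n = i" "row_index (dims A) n is = j"
        "?U $$ (j, i) = entry U is"
        using unfold_mat_index[of n U j i] mn i j dU by auto
      have "(Mn\<^sup>T *\<^sub>v row ?U j) $ i = (?U * Mn) $$ (j, i)"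
        using i j Mn Uc comm_scalar_prod[of "col Mn i" "dims A ! n" "row ?U j"] by simp
      also have "\<dots> = unfold_mat (mode_prod U n Mn\<^sup>T) n $$ (j, i)"
        using unfold_mode_prod[of n U "Mn\<^sup>T"] mn dU Mn by simp
      also have "\<dots> = entry (mode_prod U n Mn\<^sup>T) is"
        using unfold_entry[of "is" "mode_prod U n Mn\<^sup>T" n] "is" mn dU Mn by simp
      also have "\<dots> = d j * ?U $$ (j, i)"
        using UMe[OF "is"(1)] d[OF "is"(1)] "is" by simp
      finally show "(Mn\<^sup>T *\<^sub>v row ?U j) $ i = (d j \<cdot>\<^sub>v row ?U j) $ i"
        using i j dU by simp
    qed (use Mn Uc in auto)
  qed
qed

section \<open>Agreement of spectral projections across modes\<close>

text \<open>Both sides equal the mixed product \<open>E r r\<close>: resolving the identity in the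
  other mode writes each side as a sum of mixed products, and those with different indices
  vanish.\<close>

lemma spectral_projections_coupled:
  fixes A :: "'a :: field tensor"
  assumes mn: "m \<noteq> n" "m < length (dims A)" "n < length (dims A)"
    and Cm: "Cm \<in> carrier_mat (dims A ! m) (dims A ! m)"
    and Cn: "Cn \<in> carrier_mat (dims A ! n) (dims A ! n)"
    and eq: "mode_prod A m Cm = mode_prod A n Cn"
    and inj: "inj_on lam {..<R}"
    and P: "\<And>r. r < R \<Longrightarrow> P r \<in> carrier_mat (dims A ! m) (dims A ! m)"
    and P': "\<And>r. r < R \<Longrightarrow> P' r \<in> carrier_mat (dims A ! n) (dims A ! n)"
    and PC: "\<And>r. r < R \<Longrightarrow> P r * Cm = lam r \<cdot>\<^sub>m P r"
    and PC': "\<And>r. r < R \<Longrightarrow> P' r * Cn = lam r \<cdot>\<^sub>m P' r"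
    and P1: "\<And>i j. i < dims A ! m \<Longrightarrow> j < dims A ! m \<Longrightarrow> 1\<^sub>m (dims A ! m) $$ (i, j) = (\<Sum>r<R. P r $$ (i, j))"
    and P1': "\<And>i j. i < dims A ! n \<Longrightarrow> j < dims A ! n \<Longrightarrow> 1\<^sub>m (dims A ! n) $$ (i, j) = (\<Sum>r<R. P' r $$ (i, j))"
    and r: "r < R"
  shows "mode_prod A m (P r) = mode_prod A n (P' r)"
proof -
  define E where "E r s = mode_prod (mode_prod A m (P r)) n (P' s)" for r s
  have E': "E r s = mode_prod (mode_prod A n (P' s)) m (P r)" if "r < R" "s < R" for r s
    unfolding E_def using mn carrier_matD[OF P[OF that(1)]] carrier_matD[OF P'[OF that(2)]]
    by (intro mode_prod_commute) auto
  have dE: "dims (E r s) = dims A" if "r < R" "s < R" for r s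
    using carrier_matD[OF P[OF that(1)]] carrier_matD[OF P'[OF that(2)]] by (simp add: E_def)
  have cross: "entry (E r s) is = 0"
    if rs: "r < R" "s < R" "r \<noteq> s" and "is": "is \<in> index_set (dims A)" for r s "is"
  proof -
    note cP = carrier_matD[OF P[OF rs(1)]] and cP' = carrier_matD[OF P'[OF rs(2)]]
      and cC = carrier_matD[OF Cm] carrier_matD[OF Cn]
    \<comment> \<open>\<open>Cm\<close> produces the factor \<open>lam r\<close>; \<open>eq\<close>
      trades it for \<open>Cn\<close>, which produces \<open>lam s\<close>. As these scalars differ,
      the entry vanishes.\<close>
    have "tensor_scale (lam r) (E r s) = mode_prod (mode_prod A n (P' s)) m (P r * Cm)"
      unfolding PC[OF rs(1)] E'[OF rs(1,2)] using mn by (intro mode_prod_smult[symmetric]) simp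
    also have "\<dots> = mode_prod (mode_prod (mode_prod A n (P' s)) m Cm) m (P r)"
      using mn cP cP' cC by (intro mode_prod_mult[symmetric]) auto
    also have "mode_prod (mode_prod A n (P' s)) m Cm = mode_prod (mode_prod A m Cm) n (P' s)"
      using mn cP' cC by (intro mode_prod_commute) auto
    also have "mode_prod (mode_prod (mode_prod A m Cm) n (P' s)) m (P r)
        = mode_prod (mode_prod (mode_prod A n Cn) m (P r)) n (P' s)"
      unfolding eq using mn cP cP' cC by (intro mode_prod_commute) auto
    also have "mode_prod (mode_prod A n Cn) m (P r) = mode_prod (mode_prod A m (P r)) n Cn"
      using mn cP cC by (intro mode_prod_commute) auto
    also have "mode_prod (mode_prod (mode_prod A m (P r)) n Cn) n (P' s)
        = mode_prod (mode_prod A m (P r)) n (P' s * Cn)"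
      using mn cP cP' cC by (intro mode_prod_mult) auto
    also have "\<dots> = tensor_scale (lam s) (E r s)"
      unfolding PC'[OF rs(2)] E_def using mn by (intro mode_prod_smult) simp
    finally have "entry (tensor_scale (lam r) (E r s)) is = entry (tensor_scale (lam s) (E r s)) is"
      by simp
    hence "lam r * entry (E r s) is = lam s * entry (E r s) is"
      using "is" dE[OF rs(1,2)] by (simp add: tensor_scale_def)
    moreover have "lam r \<noteq> lam s" using inj rs by (auto simp: inj_on_def)
    ultimately show ?thesis by simp
  qed
  show ?thesis
  proof (rule tensor_eqI)
    note cP = carrier_matD[OF P[OF r]] and cP' = carrier_matD[OF P'[OF r]]
    show "dims (mode_prod A m (P r)) = dims (mode_prod A n (P' r))" using cP cP' by simp
    fix "is" assume "is \<in> index_set (dims (mode_prod A m (P r)))"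
    hence "is": "is \<in> index_set (dims A)" using cP by simp
    have d: "dims (mode_prod A m (P r)) = dims A" "dims (mode_prod A n (P' r)) = dims A"
      using cP cP' by auto
    have "entry (mode_prod A m (P r)) is = entry (mode_prod (mode_prod A m (P r)) n (1\<^sub>m (dims A ! n))) is"
      using mode_prod_one[of n "mode_prod A m (P r)"] mn d by simp
    also have "\<dots> = (\<Sum>s<R. 1 * entry (E r s) is)"
      unfolding E_def using mn d "is" P' P1' by (intro entry_mode_prod_sum[where a = "dims A ! n" and b = "dims A ! n"]) auto
    also have "\<dots> = (\<Sum>s<R. if s = r then entry (E r r) is else 0)"
      using cross[OF r _ _ "is"] by (intro sum.cong) auto
    also have "\<dots> = (\<Sum>s<R. 1 * entry (E s r) is)"
      using cross[OF _ r _ "is"] by (intro sum.cong) auto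
    also have "\<dots> = (\<Sum>s<R. 1 * entry (mode_prod (mode_prod A n (P' r)) m (P s)) is)"
      using E'[OF _ r] by (intro sum.cong) auto
    also have "\<dots> = entry (mode_prod (mode_prod A n (P' r)) m (1\<^sub>m (dims A ! m))) is"
      using mn d "is" P P1 by (intro entry_mode_prod_sum[symmetric, where a = "dims A ! m" and b = "dims A ! m"]) auto
    also have "\<dots> = entry (mode_prod A n (P' r)) is"
      using mode_prod_one[of m "mode_prod A n (P' r)"] mn d by simp
    finally show "entry (mode_prod A m (P r)) is = entry (mode_prod A n (P' r)) is" .
  qed
qed

section \<open>Rank-one tensors\<close>

text \<open>The rows of \<open>is\<close> and \<open>js\<close> and the columns
  \<open>is ! n\<close> and \<open>js ! n\<close> form a 2 by 2 minor of the unfolding, which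
  vanishes because the rank is 1.\<close>

lemma entry_swap_of_rank_one_unfold:
  fixes T :: "'a :: field tensor"
  assumes rk: "mat_rank (unfold_mat T n) = 1" and n: "n < length (dims T)"
    and "is": "is \<in> index_set (dims T)" and js: "js \<in> index_set (dims T)"
  shows "entry T is * entry T js = entry T (is[n := js ! n]) * entry T (js[n := is ! n])"
proof -
  let ?U = "unfold_mat T n"
  have 1: "is[n := js ! n] \<in> index_set (dims T)" "js[n := is ! n] \<in> index_set (dims T)"
    using index_set_update_other[OF "is" index_set_nth[OF js n], of n]
      index_set_update_other[OF js index_set_nth[OF "is" n], of n] by simp_all
  have 2: "is[n := js ! n] ! n = js ! n" "js[n := is ! n] ! n = is ! n"
    using n index_set_length[OF "is"] index_set_length[OF js] by auto
  have r: "row_index (dims T) n ks < dim_row ?U" if "ks \<in> index_set (dims T)" for ks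
    using row_index_less[OF that, of n] by simp
  have "?U $$ (row_index (dims T) n is, is ! n) * ?U $$ (row_index (dims T) n js, js ! n)
      = ?U $$ (row_index (dims T) n is, js ! n) * ?U $$ (row_index (dims T) n js, is ! n)"
    by (rule mat_rank_one_minor[OF unfold_carrier rk r[OF "is"] r[OF js] index_set_nth[OF "is" n] index_set_nth[OF js n]])
  thus ?thesis
    using unfold_entry[OF "is" n] unfold_entry[OF js n] unfold_entry[OF 1(1) n] unfold_entry[OF 1(2) n] 2
    by (simp add: row_index_update)
qed

text \<open>
  With \<open>s\<close> an index of a nonzero entry, replacing the indices of \<open>is\<close> by those of \<open>s\<close>
  one mode at a time gives
  \<open>T(is) * T(s)^(N - 1) = (\<Prod>n<N. T(s[n := is ! n]))\<close>; the last mode needs no rank condition.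
\<close>

lemma rank_oneI:
  fixes T :: "'a :: field tensor"
  assumes nz: "T \<noteq> tensor (dims T) (\<lambda>_. 0)" and len: "length (dims T) = Suc N"
    and rk: "\<And>n. n < N \<Longrightarrow> mat_rank (unfold_mat T n) = 1"
  shows "rank_one T"
proof -
  have "\<exists>s \<in> index_set (dims T). entry T s \<noteq> 0"
  proof (rule ccontr)
    assume "\<not> ?thesis"
    hence "T = tensor (dims T) (\<lambda>_. 0)" by (intro tensor_eqI) auto
    with nz show False ..
  qed
  then obtain s where s: "s \<in> index_set (dims T)" and t: "entry T s \<noteq> 0" by blast
  have ls: "length s = Suc N" using index_set_length[OF s] len by simp
  have step: "entry T is * entry T s ^ k = entry T (take k s @ drop k is) * (\<Prod>n<k. entry T (s[n := is ! n]))"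
    if "k \<le> N" and "is": "is \<in> index_set (dims T)" for k "is"
    using that(1)
  proof (induction k)
    case (Suc k)
    have li: "length is = Suc N" using index_set_length[OF "is"] len by simp
    let ?J = "take k s @ drop k is"
    have J: "?J \<in> index_set (dims T)"
      using s "is" li ls Suc.prems len by (auto simp: index_set_def nth_append)
    have Jk: "?J ! k = is ! k" using li ls Suc.prems by (simp add: nth_append)
    have "?J[k := s ! k] = take (Suc k) s @ drop (Suc k) is"
      using li ls Suc.prems by (intro nth_equalityI) (auto simp: nth_append nth_list_update less_Suc_eq)
    moreover have "entry T ?J * entry T s = entry T (?J[k := s ! k]) * entry T (s[k := ?J ! k])"
      using Suc.prems len by (intro entry_swap_of_rank_one_unfold[OF rk _ J s]) auto
    ultimately have sw: "entry T ?J * entry T s = entry T (take (Suc k) s @ drop (Suc k) is) * entry T (s[k := is ! k])"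
      using Jk by simp
    have "entry T is * entry T s ^ Suc k = (entry T is * entry T s ^ k) * entry T s" by simp
    also have "\<dots> = (entry T ?J * entry T s) * (\<Prod>n<k. entry T (s[n := is ! n]))"
      using Suc by (simp add: mult_ac)
    also have "\<dots> = entry T (take (Suc k) s @ drop (Suc k) is) * (\<Prod>n<Suc k. entry T (s[n := is ! n]))"
      unfolding sw by (simp add: mult_ac)
    finally show ?case .
  qed simp
  \<comment> \<open>After \<open>N\<close> exchanges only the last index of \<open>is\<close> is
    left, so the remaining factor already has the form
    \<open>entry T (s[N := is ! N])\<close>.\<close>
  have main: "entry T is * entry T s ^ N = (\<Prod>n<Suc N. entry T (s[n := is ! n]))"
    if "is": "is \<in> index_set (dims T)" for "is"
  proof -
    have li: "length is = Suc N" using index_set_length[OF "is"] len by simp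
    have "take N s @ drop N is = s[N := is ! N]"
      using li ls by (intro nth_equalityI) (auto simp: nth_append nth_list_update less_Suc_eq)
    thus ?thesis using step[OF order_refl "is"] by (simp add: mult.commute)
  qed
  \<comment> \<open>The constant \<open>entry T s ^ N\<close> has to be divided out exactly once;
    this is done in mode \<open>0\<close>.\<close>
  define v where "v n = vec (dims T ! n) (\<lambda>i. (if n = 0 then inverse (entry T s ^ N) else 1) * entry T (s[n := i]))" for n
  have "T = tensor (dims T) (\<lambda>is. \<Prod>n < length (dims T). v n $ (is ! n))"
  proof (rule tensor_eqI)
    fix "is" assume "is": "is \<in> index_set (dims T)"
    have "(\<Prod>n < length (dims T). v n $ (is ! n))
        = (\<Prod>n<Suc N. (if n = 0 then inverse (entry T s ^ N) else 1) * entry T (s[n := is ! n]))"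
      unfolding len using index_set_nth[OF "is"] len by (intro prod.cong) (auto simp: v_def)
    also have "\<dots> = (\<Prod>n<Suc N. if n = 0 then inverse (entry T s ^ N) else 1) * (\<Prod>n<Suc N. entry T (s[n := is ! n]))"
      by (rule prod.distrib)
    also have "(\<Prod>n<Suc N. if n = 0 then inverse (entry T s ^ N) else 1) = inverse (entry T s ^ N)"
      by (subst prod.delta) auto
    also have "inverse (entry T s ^ N) * (\<Prod>n<Suc N. entry T (s[n := is ! n])) = entry T is"
      unfolding main[OF "is", symmetric] using t by simp
    finally show "entry T is = entry (tensor (dims T) (\<lambda>is. \<Prod>n < length (dims T). v n $ (is ! n))) is"
      using "is" by simp
  qed simp
  moreover have "v n \<in> carrier_vec (dims T ! n)" for n by (simp add: v_def)
  ultimately show ?thesis using nz unfolding rank_one_def by blast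
qed

section \<open>The decomposition\<close>

lemma coupled_decomposition:
  fixes A B :: "'a :: field tensor"
  assumes Nh: "2 \<le> Nh" "Nh \<le> length (dims A)" and dB: "dims B = dims A"
    and inj: "\<And>n. n < Nh \<Longrightarrow> inj_mat (unfold_mat A n)"
    and M: "\<And>n. n < Nh \<Longrightarrow> M n \<in> carrier_mat (dims A ! n) (dims A ! n)"
    and AM: "\<And>n. n < Nh \<Longrightarrow> mode_prod A n (M n)\<^sup>T = B"
    and lam: "inj_on lam {..<R}" "\<And>r. r < R \<Longrightarrow> lam r \<noteq> 0"
    and X: "\<And>n r. n < Nh \<Longrightarrow> r < R \<Longrightarrow> X n r \<in> carrier_mat (dims A ! n) (L n r)"
    and inv: "\<And>n. n < Nh \<Longrightarrow> invertible_mat (hcat (dims A ! n) (map (X n) [0..<R]))"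
    and M_eq: "\<And>n. n < Nh \<Longrightarrow> M n = the (mat_inverse (hcat (dims A ! n) (map (X n) [0..<R]))\<^sup>T)
        * diag_block_mat (map (\<lambda>r. lam r \<cdot>\<^sub>m 1\<^sub>m (L n r)) [0..<R])
        * (hcat (dims A ! n) (map (X n) [0..<R]))\<^sup>T"
  obtains D where "\<And>r. r < R \<Longrightarrow> dims (D r) = core_dims Nh (dims A) L r"
    and "ml_decomposition Nh R L (\<lambda>r. multi_prod Nh (D r) (\<lambda>n. X n r)) A"
    and "ml_decomposition Nh R L (\<lambda>r. tensor_scale (lam r) (multi_prod Nh (D r) (\<lambda>n. X n r))) B"
proof -
  \<comment> \<open>\<open>\<Phi>\<close> bundles the properties of the dual blocks in one mode, so
    that blocks can be chosen for all modes at once.\<close>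
  define \<Phi> where "\<Phi> n Y \<longleftrightarrow>
      (\<forall>r<R. Y r \<in> carrier_mat (L n r) (dims A ! n) \<and> Y r * X n r = 1\<^sub>m (L n r)
        \<and> Y r * (M n)\<^sup>T = lam r \<cdot>\<^sub>m Y r)
      \<and> (\<forall>i < dims A ! n. \<forall>j < dims A ! n.
        1\<^sub>m (dims A ! n) $$ (i, j) = (\<Sum>r<R. (X n r * Y r) $$ (i, j)))" for n and Y :: "nat \<Rightarrow> 'a mat"
  have "\<exists>Y. n < Nh \<longrightarrow> \<Phi> n Y" for n
  proof (cases "n < Nh")
    case True
    show ?thesis
    proof (rule hcat_dual_blocks[of R "X n" "dims A ! n" "L n", OF X[OF True] inv[OF True]], assumption)
      fix Y assume Y: "\<And>r. r < R \<Longrightarrow> Y r \<in> carrier_mat (L n r) (dims A ! n)"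
        "\<And>r. r < R \<Longrightarrow> Y r * X n r = 1\<^sub>m (L n r)"
        "\<And>i j. i < dims A ! n \<Longrightarrow> j < dims A ! n
          \<Longrightarrow> 1\<^sub>m (dims A ! n) $$ (i, j) = (\<Sum>r<R. (X n r * Y r) $$ (i, j))"
        and ev: "\<And>K lam r. r < R \<Longrightarrow> K \<in> carrier_mat (dims A ! n) (dims A ! n)
          \<Longrightarrow> K = the (mat_inverse (hcat (dims A ! n) (map (X n) [0..<R]))\<^sup>T)
                * diag_block_mat (map (\<lambda>r. lam r \<cdot>\<^sub>m 1\<^sub>m (L n r)) [0..<R])
                * (hcat (dims A ! n) (map (X n) [0..<R]))\<^sup>T
          \<Longrightarrow> Y r * K\<^sup>T = lam r \<cdot>\<^sub>m Y r"
      have "\<Phi> n Y" unfolding \<Phi>_def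
      proof (intro conjI allI impI)
        fix r assume r: "r < R"
        show "Y r \<in> carrier_mat (L n r) (dims A ! n)" by (rule Y(1)[OF r])
        show "Y r * X n r = 1\<^sub>m (L n r)" by (rule Y(2)[OF r])
        show "Y r * (M n)\<^sup>T = lam r \<cdot>\<^sub>m Y r" by (rule ev[OF r M[OF True] M_eq[OF True]])
      next
        fix i j assume "i < dims A ! n" "j < dims A ! n"
        thus "1\<^sub>m (dims A ! n) $$ (i, j) = (\<Sum>r<R. (X n r * Y r) $$ (i, j))" by (rule Y(3))
      qed
      thus ?thesis by blast
    qed
  qed simp
  then obtain Y where Y\<Phi>: "\<And>n. n < Nh \<Longrightarrow> \<Phi> n (Y n)" by metis
  have Y: "Y n r \<in> carrier_mat (L n r) (dims A ! n)" and YX: "Y n r * X n r = 1\<^sub>m (L n r)"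
    and YM: "Y n r * (M n)\<^sup>T = lam r \<cdot>\<^sub>m Y n r" if "n < Nh" "r < R" for n r
    using Y\<Phi>[OF that(1)] that(2) unfolding \<Phi>_def by blast+
  define P where "P n r = X n r * Y n r" for n r
  have P: "P n r \<in> carrier_mat (dims A ! n) (dims A ! n)" if "n < Nh" "r < R" for n r
    unfolding P_def by (rule mult_carrier_mat[OF X[OF that] Y[OF that]])
  have P1: "1\<^sub>m (dims A ! n) $$ (i, j) = (\<Sum>r<R. P n r $$ (i, j))"
    if "n < Nh" "i < dims A ! n" "j < dims A ! n" for n i j
    using Y\<Phi>[OF that(1)] that(2,3) unfolding \<Phi>_def P_def by blast
  have PM: "P n r * (M n)\<^sup>T = lam r \<cdot>\<^sub>m P n r" if nr: "n < Nh" "r < R" for n r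
  proof -
    have "P n r * (M n)\<^sup>T = X n r * (Y n r * (M n)\<^sup>T)"
      unfolding P_def by (rule assoc_mult_mat[OF X[OF nr] Y[OF nr]]) (use M[OF nr(1)] in simp)
    also have "\<dots> = lam r \<cdot>\<^sub>m P n r"
      unfolding YM[OF nr] P_def by (rule mult_smult_distrib[OF X[OF nr] Y[OF nr]])
    finally show ?thesis .
  qed
  have PP: "P n r * P n r = P n r" if nr: "n < Nh" "r < R" for n r
  proof -
    have "P n r * P n r = X n r * (Y n r * P n r)"
      by (subst (1) P_def) (rule assoc_mult_mat[OF X[OF nr] Y[OF nr] P[OF nr]])
    also have "Y n r * P n r = Y n r * X n r * Y n r"
      unfolding P_def by (rule assoc_mult_mat[OF Y[OF nr] X[OF nr] Y[OF nr], symmetric])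
    also have "\<dots> = Y n r" unfolding YX[OF nr] by (rule left_mult_one_mat[OF Y[OF nr]])
    finally show ?thesis by (simp add: P_def)
  qed
  \<comment> \<open>The \<open>r\<close>th term, defined through mode \<open>0\<close>;
    \<open>SP\<close> shows that every mode below \<open>Nh\<close> gives the same tensor.\<close>
  define S where "S r = mode_prod A 0 (P 0 r)" for r
  have Nh0: "0 < Nh" using Nh by simp
  have len: "n < length (dims A)" if "n < Nh" for n using that Nh by simp
  have SP: "mode_prod A n (P n r) = S r" if nr: "n < Nh" "r < R" for n r
  proof (cases "n = 0")
    case False
    have MT: "(M k)\<^sup>T \<in> carrier_mat (dims A ! k) (dims A ! k)" if "k < Nh" for k using M[OF that] by simp
    have eq: "mode_prod A n (M n)\<^sup>T = mode_prod A 0 (M 0)\<^sup>T" using AM[OF nr(1)] AM[OF Nh0] by simp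
    show ?thesis unfolding S_def
      by (rule spectral_projections_coupled[OF False len[OF nr(1)] len[OF Nh0] MT[OF nr(1)] MT[OF Nh0] eq lam(1)
            P[OF nr(1)] P[OF Nh0] PM[OF nr(1)] PM[OF Nh0] P1[OF nr(1)] P1[OF Nh0] nr(2)])
  qed (simp add: S_def)
  have dS: "dims (S r) = dims A" if "r < R" for r
    using carrier_matD[OF P[OF Nh0 that]] by (simp add: S_def)
  define D where "D r = multi_prod Nh A (\<lambda>n. Y n r)" for r
  have T: "multi_prod Nh (D r) (\<lambda>n. X n r) = S r" if r: "r < R" for r
  proof -
    \<comment> \<open>The first projection already yields \<open>S r\<close>, and each further one
      leaves it fixed by \<open>SP\<close> and idempotence.\<close>
    have step: "multi_prod (Suc k) A (\<lambda>n. P n r) = S r" if "k < Nh" for k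
      using that
    proof (induction k)
      case (Suc k)
      note cP = carrier_matD[OF P[OF Suc.prems r]]
      have "multi_prod (Suc (Suc k)) A (\<lambda>n. P n r) = mode_prod (S r) (Suc k) (P (Suc k) r)"
        using Suc by simp
      also have "\<dots> = mode_prod A (Suc k) (P (Suc k) r * P (Suc k) r)"
        unfolding SP[OF Suc.prems r, symmetric]
        by (rule mode_prod_mult[OF len[OF Suc.prems]]) (simp_all add: cP)
      also have "\<dots> = S r" unfolding PP[OF Suc.prems r] by (rule SP[OF Suc.prems r])
      finally show ?case .
    qed (simp add: S_def)
    have "multi_prod Nh (D r) (\<lambda>n. X n r) = multi_prod Nh A (\<lambda>n. P n r)"
      unfolding D_def P_def
      by (rule multi_prod_mult[OF Nh(2)])
        (simp_all only: carrier_matD[OF X[OF _ r]] carrier_matD[OF Y[OF _ r]])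
    also have "\<dots> = S r" using step[of "Nh - 1"] Nh0 by simp
    finally show ?thesis .
  qed
  \<comment> \<open>The scalar is carried along to cover the terms of \<open>A\<close> with
    \<open>c = 1\<close> and those of \<open>B\<close> with \<open>c = lam r\<close>. The unfolding
    is a product of two injective matrices, from \<open>A\<close> and \<open>Y n r\<close>, and of
    the transpose of \<open>X n r\<close>, which has a right inverse and so preserves the
    rank.\<close>
  have rank: "mat_rank (c \<cdot>\<^sub>m unfold_mat (S r) n) = L n r" if nr: "n < Nh" "r < R" and c: "c \<noteq> 0" for n r c
  proof -
    let ?U = "unfold_mat A n"
    have XT: "(X n r)\<^sup>T \<in> carrier_mat (L n r) (dims A ! n)" using X[OF nr] by simp
    have YT: "(Y n r)\<^sup>T \<in> carrier_mat (dims A ! n) (L n r)" using Y[OF nr] by simp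
    have XYT: "(X n r)\<^sup>T * (Y n r)\<^sup>T = 1\<^sub>m (L n r)"
      using transpose_mult[OF Y[OF nr] X[OF nr]] YX[OF nr] by simp
    have cY: "c \<cdot>\<^sub>m (Y n r)\<^sup>T \<in> carrier_mat (dims A ! n) (L n r)" using YT by simp
    have "unfold_mat (S r) n = ?U * (P n r)\<^sup>T"
      unfolding SP[OF nr, symmetric]
      by (rule unfold_mode_prod[OF len[OF nr(1)] carrier_matD(2)[OF P[OF nr]]])
    also have "(P n r)\<^sup>T = (Y n r)\<^sup>T * (X n r)\<^sup>T"
      unfolding P_def by (rule transpose_mult[OF X[OF nr] Y[OF nr]])
    finally have "c \<cdot>\<^sub>m unfold_mat (S r) n = ?U * (c \<cdot>\<^sub>m ((Y n r)\<^sup>T * (X n r)\<^sup>T))"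
      using mult_smult_distrib[OF unfold_carrier[of A n] mult_carrier_mat[OF YT XT], of c] by simp
    also have "c \<cdot>\<^sub>m ((Y n r)\<^sup>T * (X n r)\<^sup>T) = (c \<cdot>\<^sub>m (Y n r)\<^sup>T) * (X n r)\<^sup>T"
      by (rule mult_smult_assoc_mat[OF YT XT, symmetric])
    also have "?U * ((c \<cdot>\<^sub>m (Y n r)\<^sup>T) * (X n r)\<^sup>T) = (?U * (c \<cdot>\<^sub>m (Y n r)\<^sup>T)) * (X n r)\<^sup>T"
      by (rule assoc_mult_mat[OF unfold_carrier cY XT, symmetric])
    also have "mat_rank \<dots> = mat_rank (?U * (c \<cdot>\<^sub>m (Y n r)\<^sup>T))"
      by (rule mat_rank_mult_right_inverse[OF mult_carrier_mat[OF unfold_carrier cY] XT YT XYT])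
    also have "\<dots> = L n r"
    proof (rule mat_rank_inj[OF _ mult_carrier_mat[OF unfold_carrier cY]])
      have "(inverse c \<cdot>\<^sub>m (X n r)\<^sup>T) * (c \<cdot>\<^sub>m (Y n r)\<^sup>T) = inverse c \<cdot>\<^sub>m (c \<cdot>\<^sub>m ((X n r)\<^sup>T * (Y n r)\<^sup>T))"
        using mult_smult_assoc_mat[OF XT cY, of "inverse c"] mult_smult_distrib[OF XT YT, of c] by simp
      also have "\<dots> = 1\<^sub>m (L n r)" unfolding XYT using c by (intro eq_matI) auto
      finally have "inj_mat (c \<cdot>\<^sub>m (Y n r)\<^sup>T)"
        by (rule inj_mat_left_inverse[OF _ cY, rotated]) (use XT in simp)
      thus "inj_mat (?U * (c \<cdot>\<^sub>m (Y n r)\<^sup>T))"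
        by (rule inj_mat_mult[OF inj[OF nr(1)] _ unfold_carrier cY])
    qed
    finally show ?thesis .
  qed
  have rank_scale: "mat_rank (unfold_mat (tensor_scale c (S r)) n) = L n r"
    if nr: "n < Nh" "r < R" and c: "c \<noteq> 0" for n r c
    using rank[OF nr c] dS[OF nr(2)] len[OF nr(1)] by (simp add: unfold_tensor_scale)
  have scale_one: "tensor_scale 1 (S r) = S r" for r
    by (intro tensor_eqI) (auto simp: tensor_scale_def)
  have AS: "A = tensor_sum (dims A) R S"
  proof (rule tensor_eqI)
    fix "is" assume "is": "is \<in> index_set (dims A)"
    have "entry A is = entry (mode_prod A 0 (1\<^sub>m (dims A ! 0))) is"
      using mode_prod_one[OF len[OF Nh0]] by simp
    also have "\<dots> = (\<Sum>r<R. 1 * entry (mode_prod A 0 (P 0 r)) is)"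
      by (rule entry_mode_prod_sum[OF len[OF Nh0] one_carrier_mat P[OF Nh0]])
        (use P1[OF Nh0] "is" in simp_all)
    finally show "entry A is = entry (tensor_sum (dims A) R S) is"
      using "is" by (simp add: tensor_sum_def S_def)
  qed (simp add: tensor_sum_def)
  have BS: "B = tensor_sum (dims B) R (\<lambda>r. tensor_scale (lam r) (S r))"
  proof (rule tensor_eqI)
    fix "is" assume "is \<in> index_set (dims B)"
    hence "is": "is \<in> index_set (dims A)" using dB by simp
    have MT: "(M 0)\<^sup>T \<in> carrier_mat (dims A ! 0) (dims A ! 0)" using M[OF Nh0] by simp
    \<comment> \<open>The identity is resolved into the projections, and each of them turns the
      transposed matrix into a multiplication by its eigenvalue.\<close>
    have MS: "(M 0)\<^sup>T $$ (i, j) = (\<Sum>r<R. lam r * P 0 r $$ (i, j))"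
      if ij: "i < dims A ! 0" "j < dims A ! 0" for i j
    proof -
      have "(M 0)\<^sup>T $$ (i, j) = (1\<^sub>m (dims A ! 0) * (M 0)\<^sup>T) $$ (i, j)"
        unfolding left_mult_one_mat[OF MT] ..
      also have "\<dots> = (\<Sum>l<dims A ! 0. 1\<^sub>m (dims A ! 0) $$ (i, l) * (M 0)\<^sup>T $$ (l, j))"
        by (rule index_mult_mat_sum[OF one_carrier_mat MT ij])
      also have "\<dots> = (\<Sum>l<dims A ! 0. \<Sum>r<R. P 0 r $$ (i, l) * (M 0)\<^sup>T $$ (l, j))"
        using P1[OF Nh0 ij(1)] by (intro sum.cong) (simp_all only: sum_distrib_right lessThan_iff)
      also have "\<dots> = (\<Sum>r<R. \<Sum>l<dims A ! 0. P 0 r $$ (i, l) * (M 0)\<^sup>T $$ (l, j))"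
        by (rule sum.swap)
      also have "\<dots> = (\<Sum>r<R. lam r * P 0 r $$ (i, j))"
      proof (rule sum.cong)
        fix r assume "r \<in> {..<R}"
        hence r: "r < R" by simp
        have "(\<Sum>l<dims A ! 0. P 0 r $$ (i, l) * (M 0)\<^sup>T $$ (l, j)) = (lam r \<cdot>\<^sub>m P 0 r) $$ (i, j)"
          unfolding PM[OF Nh0 r, symmetric] by (rule index_mult_mat_sum[OF P[OF Nh0 r] MT ij, symmetric])
        also have "\<dots> = lam r * P 0 r $$ (i, j)"
          using ij carrier_matD[OF P[OF Nh0 r]] by simp
        finally show "(\<Sum>l<dims A ! 0. P 0 r $$ (i, l) * (M 0)\<^sup>T $$ (l, j)) = lam r * P 0 r $$ (i, j)" .
      qed simp
      finally show ?thesis .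
    qed
    have "entry B is = (\<Sum>r<R. lam r * entry (mode_prod A 0 (P 0 r)) is)"
      unfolding AM[OF Nh0, symmetric]
      by (rule entry_mode_prod_sum[OF len[OF Nh0] MT P[OF Nh0]]) (use MS "is" in simp_all)
    also have "\<dots> = (\<Sum>r<R. entry (tensor_scale (lam r) (S r)) is)"
      by (rule sum.cong) (use "is" dS in \<open>simp_all add: tensor_scale_def S_def\<close>)
    finally show "entry B is = entry (tensor_sum (dims B) R (\<lambda>r. tensor_scale (lam r) (S r))) is"
      using "is" dB by (simp add: tensor_sum_def)
  qed (simp add: tensor_sum_def)
  show thesis
  proof
    show "dims (D r) = core_dims Nh (dims A) L r" if "r < R" for r
      unfolding D_def dims_multi_prod core_dims_def
      using carrier_matD(1)[OF Y[OF _ that]] by (intro map_cong) simp_all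
    have "tensor_sum (dims A) R (\<lambda>r. multi_prod Nh (D r) (\<lambda>n. X n r)) = tensor_sum (dims A) R S"
      by (simp add: tensor_sum_def T)
    thus "ml_decomposition Nh R L (\<lambda>r. multi_prod Nh (D r) (\<lambda>n. X n r)) A"
      unfolding ml_decomposition_def ml_rank_def
      using AS T dS rank_scale[of _ _ 1] by (simp add: scale_one)
    have "tensor_sum (dims B) R (\<lambda>r. tensor_scale (lam r) (multi_prod Nh (D r) (\<lambda>n. X n r)))
        = tensor_sum (dims B) R (\<lambda>r. tensor_scale (lam r) (S r))"
      by (simp add: tensor_sum_def T)
    thus "ml_decomposition Nh R L (\<lambda>r. tensor_scale (lam r) (multi_prod Nh (D r) (\<lambda>n. X n r))) B"
      unfolding ml_decomposition_def ml_rank_def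
      using BS T dS dB rank_scale lam(2) by (simp add: tensor_scale_def[of _ "S _"])
  qed
qed

section \<open>Spectra, diagonalizability and common decomposition of the given tensors\<close>

text \<open>In the rank-one claim, mode ranks 1 in the first \<open>Nh\<close> modes split off one
  vector per mode and leave a tensor in the remaining modes. If at most one mode remains, this is at
  most a vector; otherwise mode ranks 1 are also required there, since two free modes could carry a
  matrix of higher rank.\<close>

theorem theorem2p1:
  fixes A B :: "complex tensor" and Is :: "nat list" and Nh Rt :: nat
    and Lt :: "nat \<Rightarrow> nat \<Rightarrow> nat" and Dt :: "nat \<Rightarrow> complex tensor"
    and Xt :: "nat \<Rightarrow> nat \<Rightarrow> complex mat" and M :: "nat \<Rightarrow> complex mat"
  assumes dims_pos: "\<forall>k < length Is. 0 < Is ! k"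
    and dims_A: "dims A = Is" and dims_B: "dims B = Is"
    and Nh: "2 \<le> Nh" "Nh \<le> length Is"
    and col: "\<forall>n < Nh. mat_col_space (unfold_mat A n) = mat_col_space (unfold_mat B n)"
    and Dt: "\<forall>r < Rt. dims (Dt r) = core_dims Nh Is Lt r"
    and Xt: "\<forall>n < Nh. \<forall>r < Rt. Xt n r \<in> carrier_mat (Is ! n) (Lt n r)"
    and decomp_A: "ml_decomposition Nh Rt Lt (\<lambda>r. multi_prod Nh (Dt r) (\<lambda>n. Xt n r)) A"
    and Xt_nonsing: "\<forall>n < Nh. invertible_mat (hcat (Is ! n) (map (Xt n) [0..<Rt]))"
    and M: "\<forall>n < Nh. M n \<in> carrier_mat (Is ! n) (Is ! n)"
    and B_eq: "\<forall>n < Nh. unfold_mat B n = unfold_mat A n * M n"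
    and diag: "\<exists>n < Nh. diagonalizable_mat (M n)"
  shows
    "(\<forall>m < Nh. \<forall>n < Nh. spectrum (M m) = spectrum (M n)) \<and>
     (\<forall>n < Nh. diagonalizable_mat (M n)) \<and>
     (\<forall>(R :: nat) (lam :: nat \<Rightarrow> complex) (L :: nat \<Rightarrow> nat \<Rightarrow> nat) (X :: nat \<Rightarrow> nat \<Rightarrow> complex mat).
        inj_on lam {..<R} \<longrightarrow>
        (\<forall>n < Nh. spectrum (M n) = lam ` {..<R}) \<longrightarrow>
        (\<forall>n < Nh. \<forall>r < R. L n r = order (lam r) (char_poly (M n))) \<longrightarrow>
        (\<forall>n < Nh. \<forall>r < R. X n r \<in> carrier_mat (Is ! n) (L n r)) \<longrightarrow>
        (\<forall>n < Nh. let Xn = hcat (Is ! n) (map (X n) [0..<R]) in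
            invertible_mat Xn \<and>
            M n = the (mat_inverse Xn\<^sup>T)
                  * diag_block_mat (map (\<lambda>r. lam r \<cdot>\<^sub>m 1\<^sub>m (L n r)) [0..<R]) * Xn\<^sup>T) \<longrightarrow>
        (\<exists>D :: nat \<Rightarrow> complex tensor. let T = (\<lambda>r. multi_prod Nh (D r) (\<lambda>n. X n r)) in
            (\<forall>r < R. dims (D r) = core_dims Nh Is L r) \<and>
            ml_decomposition Nh R L T A \<and>
            ml_decomposition Nh R L (\<lambda>r. tensor_scale (lam r) (T r)) B \<and>
            (\<Prod>r<R. lam r) \<noteq> 0 \<and>
            ((\<forall>n < Nh. \<forall>r < R. L n r = 1) \<and>
             (length Is \<le> Nh + 1 \<or>
              (\<forall>r < R. \<forall>n. Nh \<le> n \<and> n < length Is \<longrightarrow> mat_rank (unfold_mat (T r) n) = 1))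
             \<longrightarrow> (\<forall>r < R. rank_one (T r)))))"
proof -
  have Nh': "2 \<le> Nh" "Nh \<le> length (dims A)" using Nh dims_A by auto
  have inj: "inj_mat (unfold_mat A n)" if "n < Nh" for n
    by (rule inj_unfold_of_decomposition[of Nh A Rt Dt Lt Xt n])
      (use Nh' Dt Xt decomp_A Xt_nonsing that in \<open>simp_all add: dims_A\<close>)
  have M': "M n \<in> carrier_mat (dims A ! n) (dims A ! n)" if "n < Nh" for n
    using M that by (simp add: dims_A)
  have len: "n < length (dims A)" if "n < Nh" for n using that Nh' by simp
  have AM: "mode_prod A n (M n)\<^sup>T = B" if n: "n < Nh" for n
  proof (rule unfold_inject)
    note cM = carrier_matD[OF M'[OF n]]
    show d: "dims (mode_prod A n (M n)\<^sup>T) = dims B" using cM by (simp add: dims_A dims_B)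
    show "n < length (dims (mode_prod A n (M n)\<^sup>T))" using len[OF n] by simp
    show "unfold_mat (mode_prod A n (M n)\<^sup>T) n = unfold_mat B n"
      using unfold_mode_prod[OF len[OF n], of "(M n)\<^sup>T"] cM B_eq n by simp
  qed
  have AMM: "mode_prod A m (M m)\<^sup>T = mode_prod A n (M n)\<^sup>T" if "m < Nh" "n < Nh" for m n
    using AM that by simp
  have spec: "spectrum (M n) \<subseteq> spectrum (M m)" if "m < Nh" "n < Nh" for m n
    using spectrum_coupled[OF _ len[OF that(1)] len[OF that(2)] M'[OF that(1)] M'[OF that(2)] AMM[OF that] inj[OF that(2)]]
    by (cases "m = n") auto
  obtain k where k: "k < Nh" "diagonalizable_mat (M k)" using diag by blast
  have diag_all: "diagonalizable_mat (M n)" if "n < Nh" for n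
    using diagonalizable_coupled[OF _ len[OF k(1)] len[OF that] M'[OF k(1)] M'[OF that] AMM[OF k(1) that] inj[OF that] k(2)] k(2)
    by (cases "k = n") auto
  have Nh0: "0 < Nh" using Nh by simp
  \<comment> \<open>Mode \<open>0\<close> serves as representative: every \<open>lam r\<close> in
    the third statement lies in the spectrum of \<open>M 0\<close>, so all of them are
    nonzero.\<close>
  have zero: "0 \<notin> spectrum (M 0)"
    using col B_eq Nh0 by (intro zero_notin_spectrum[OF inj[OF Nh0] unfold_carrier M'[OF Nh0]]) simp
  show ?thesis
  proof (intro conjI allI impI, goal_cases)
    case (1 m n)
    thus ?case using spec by blast
  next
    case (2 n)
    thus ?case using diag_all by blast
  next
    case (3 R lam L X)
    have lam0: "lam r \<noteq> 0" if "r < R" for r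
      using 3(2) zero Nh0 that by (metis imageI lessThan_iff)
    obtain D where D: "\<And>r. r < R \<Longrightarrow> dims (D r) = core_dims Nh (dims A) L r"
      and decA: "ml_decomposition Nh R L (\<lambda>r. multi_prod Nh (D r) (\<lambda>n. X n r)) A"
      and decB: "ml_decomposition Nh R L (\<lambda>r. tensor_scale (lam r) (multi_prod Nh (D r) (\<lambda>n. X n r))) B"
    proof (rule coupled_decomposition[of Nh A B M lam R X L])
      fix D assume D: "\<And>r. r < R \<Longrightarrow> dims (D r) = core_dims Nh (dims A) L r"
        "ml_decomposition Nh R L (\<lambda>r. multi_prod Nh (D r) (\<lambda>n. X n r)) A"
        "ml_decomposition Nh R L (\<lambda>r. tensor_scale (lam r) (multi_prod Nh (D r) (\<lambda>n. X n r))) B"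
      show thesis by (rule that[OF D])
    next
      show "invertible_mat (hcat (dims A ! n) (map (X n) [0..<R]))" if "n < Nh" for n
        using 3(5) that unfolding Let_def dims_A by blast
      show "M n = the (mat_inverse (hcat (dims A ! n) (map (X n) [0..<R]))\<^sup>T)
          * diag_block_mat (map (\<lambda>r. lam r \<cdot>\<^sub>m 1\<^sub>m (L n r)) [0..<R])
          * (hcat (dims A ! n) (map (X n) [0..<R]))\<^sup>T" if "n < Nh" for n
        using 3(5) that unfolding Let_def dims_A by blast
      show "X n r \<in> carrier_mat (dims A ! n) (L n r)" if "n < Nh" "r < R" for n r
        using 3(4) that unfolding dims_A by blast
    qed (use Nh' inj M' AM 3(1) lam0 in \<open>simp_all add: dims_A dims_B\<close>)
    let ?T = "\<lambda>r. multi_prod Nh (D r) (\<lambda>n. X n r)"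
    have dT: "dims (?T r) = Is" and rT: "\<And>n. n < Nh \<Longrightarrow> mat_rank (unfold_mat (?T r) n) = L n r"
      if "r < R" for r
      using decA that by (simp_all add: ml_decomposition_def ml_rank_def dims_A)
    have one: "rank_one (?T r)"
      if L1: "\<forall>n < Nh. \<forall>r < R. L n r = 1"
        and last: "length Is \<le> Nh + 1 \<or>
          (\<forall>r < R. \<forall>n. Nh \<le> n \<and> n < length Is \<longrightarrow> mat_rank (unfold_mat (?T r) n) = 1)"
        and r: "r < R" for r
    proof (rule rank_oneI)
      show "length (dims (?T r)) = Suc (length Is - 1)" using dT[OF r] Nh by simp
      show "mat_rank (unfold_mat (?T r) n) = 1" if n: "n < length Is - 1" for n
      proof (cases "n < Nh")
        case True
        thus ?thesis using rT[OF r True] L1 r by simp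
      next
        case False
        \<comment> \<open>A mode from \<open>Nh\<close> on that is not the last one exists only if
          at least two modes remain, so the second alternative of \<open>last\<close>
          applies.\<close>
        hence "\<not> length Is \<le> Nh + 1" using n by simp
        thus ?thesis using last r n False by simp
      qed
      \<comment> \<open>A zero term would have rank 0 in mode \<open>0\<close>, where the rank is
        1.\<close>
      show "?T r \<noteq> tensor (dims (?T r)) (\<lambda>_. 0)"
      proof
        assume "?T r = tensor (dims (?T r)) (\<lambda>_. 0)"
        hence "mat_rank (unfold_mat (?T r) 0) = mat_rank (unfold_mat (tensor (dims (?T r)) (\<lambda>_. 0 :: complex)) 0)"
          by simp
        also have "\<dots> = 0"
          using dT[OF r] len[OF Nh0] by (simp add: dims_A unfold_zero mat_rank_zero)
        finally show False using rT[OF r Nh0] L1 r Nh0 by simp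
      qed
    qed
    show ?case
      unfolding Let_def
      by (rule exI[of _ D]) (use D decA decB lam0 one in \<open>auto simp: dims_A\<close>)
  qed
qed

end
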